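(* Let $X=(X_1,X_2)$ be a random vector in $\mathbb{R}^2$ with $\mathbb{E}[X_i]=0$ and $\mathbb{E}[X_iX_j]=\delta_{ij}$ for $i,j\in\{1,2\}$, and let $S(n)=X(1)+\dots+X(n)$, where $X(1),X(2),\dots$ are independent copies of $X$. Assume that there is a two-dimensional lattice $R\subset\mathbb{R}^2$ with $\mathbb{P}(S(n)\in R\text{ for all }n)=1$. Let $\alpha\in(0,\pi]$ and assume that, for every $x\in R\cap K_\alpha$, almost surely $x+S(\tau_x)\in\partial K_\alpha$. (a) If $\alpha=\pi/m$ for some integer $m\ge 2$ and $\mathbb{E}|X|^m<\infty$, then there exists a polynomial $r_m(x)$ of degree at most $m-1$ such that $h(x):=u_{\pi/m}(x)+r_m(x)$ is harmonic for $S(n)$ killed at leaving $K_{\pi/m}$. All the coefficients of $r_m(x)$ are linear combinations of mixed moments $\mathbb{E}[X_1^kX_2^l]$, $k,l\le m$. (b) If $\alpha\in(0,\pi)$ and a positive polynomial $h(x)$ has degree $m$, is harmonic for $S(n)$ killed at leaving $K_\alpha$, and $h(x)=0$ for all $x\in R\cap\partial K_\alpha$, then $\alpha=\pi/m$ and there exists a constant $c$ such that the degree of $h(x)-c\,u_{\pi/m}(x)$ does not exceed $m-1$.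
   Context: For $\alpha\in(0,\pi]$, $K_\alpha:=\{(r\cos\varphi,r\sin\varphi):r>0,\ 0<\varphi<\alpha\}$ is the open wedge of opening $\alpha$ with vertex at the origin, bounded by the rays $\varphi=0$ and $\varphi=\alpha$. For $x\in K_\alpha$, $\tau_x:=\inf\{n\ge1:x+S(n)\notin K_\alpha\}$. For an integer $m\ge1$, $u_{\pi/m}(x_1,x_2):=\Im\,(x_1+ix_2)^m$, a homogeneous polynomial of degree $m$ (in polar coordinates $r^m\sin(m\varphi)$). Polynomials are real polynomials in $x=(x_1,x_2)$. A function $f$ is called harmonic for $S(n)$ killed at leaving $K_\alpha$ if $f(x)=\mathbb{E}[f(x+X);\,x+X\in K_\alpha]$ for all $x\in K_\alpha\cap R$ (the expectation being well defined and finite). "Positive" in part (b) means $h(x)\ge0$ for all $x\in R\cap K_\alpha$.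
   Formalization: In (a), the coefficients of r_m are combinations of the moments of order k+l≤m whose scalars are law-independent polynomials in the moments of order below m; with constant scalars the claim fails from m=4 on, where products of third moments occur. *)

theory Defs
  imports "HOL-Probability.Probability" "HOL-Computational_Algebra.Polynomial"
begin

section \<open>Geometry\<close>

definition wedge :: "real \<Rightarrow> (real^2) set" where
  "wedge \<alpha> = {vector [r * cos \<phi>, r * sin \<phi>] | r \<phi>. 0 < r \<and> 0 < \<phi> \<and> \<phi> < \<alpha>}"

definition planar_lattice :: "(real^2) set \<Rightarrow> bool" where
  "planar_lattice R \<longleftrightarrow>
     (\<exists>v w. v \<noteq> w \<and> independent {v, w} \<and>
        R = {of_int a *\<^sub>R v + of_int b *\<^sub>R w | a b :: int. True})"

section \<open>Bivariate polynomials\<close>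

text \<open>
  A polynomial in \<open>x\<^sub>1, x\<^sub>2\<close> is an element of \<open>\<real>[x\<^sub>1][x\<^sub>2]\<close>: the outer
  variable is \<open>x\<^sub>2\<close>, and \<open>coeff2 p i j\<close> is the coefficient of \<open>x\<^sub>1\<^sup>i x\<^sub>2\<^sup>j\<close>.
\<close>

definition coeff2 :: "real poly poly \<Rightarrow> nat \<Rightarrow> nat \<Rightarrow> real" where
  "coeff2 p i j = coeff (coeff p j) i"

definition poly2 :: "real poly poly \<Rightarrow> real^2 \<Rightarrow> real" where
  "poly2 p x = poly (poly p [:x $ 2:]) (x $ 1)"

definition total_degree_le :: "real poly poly \<Rightarrow> nat \<Rightarrow> bool" where
  "total_degree_le p d \<longleftrightarrow> (\<forall>i j. coeff2 p i j \<noteq> 0 \<longrightarrow> i + j \<le> d)"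

text \<open>The zero polynomial has no degree in this sense.\<close>

definition has_total_degree :: "real poly poly \<Rightarrow> nat \<Rightarrow> bool" where
  "has_total_degree p d \<longleftrightarrow>
     total_degree_le p d \<and> (\<exists>i j. coeff2 p i j \<noteq> 0 \<and> i + j = d)"

text \<open>\<open>u m\<close> is \<open>u\<^bsub>\<pi>/m\<^esub>\<close>.\<close>

definition u :: "nat \<Rightarrow> real^2 \<Rightarrow> real" where
  "u m x = Im (Complex (x $ 1) (x $ 2) ^ m)"

section \<open>Random walks killed at leaving a wedge\<close>

definition walk :: "(nat \<Rightarrow> 'a \<Rightarrow> real^2) \<Rightarrow> nat \<Rightarrow> 'a \<Rightarrow> real^2" where
  "walk \<xi> n \<omega> = (\<Sum>k = 1..n. \<xi> k \<omega>)"

definition exit_time :: "(nat \<Rightarrow> 'a \<Rightarrow> real^2) \<Rightarrow> (real^2) set \<Rightarrow> real^2 \<Rightarrow> 'a \<Rightarrow> enat" where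
  "exit_time \<xi> K x \<omega> = Inf {enat n | n. 1 \<le> n \<and> x + walk \<xi> n \<omega> \<notin> K}"

text \<open>
  \<open>X\<close> is the generic increment and \<open>\<xi> 1, \<xi> 2, \<dots>\<close> are its independent copies
  (\<open>\<xi> 0\<close> is not used). The statement that the walk is on the boundary at its exit
  time includes that the exit time is finite.
\<close>

locale wedge_walk = prob_space M
  for M :: "'a measure" and X :: "'a \<Rightarrow> real^2" and \<xi> :: "nat \<Rightarrow> 'a \<Rightarrow> real^2"
    and R :: "(real^2) set" and \<alpha> :: real +
  assumes X_measurable: "X \<in> borel_measurable M"
    and mean_zero: "\<And>i. has_bochner_integral M (\<lambda>\<omega>. X \<omega> $ i) 0"
    and covariance_id:
      "\<And>i j. has_bochner_integral M (\<lambda>\<omega>. X \<omega> $ i * X \<omega> $ j) (if i = j then 1 else 0)"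
    and indep_steps: "indep_vars (\<lambda>_. borel) \<xi> {1..}"
    and distr_steps: "\<And>n. 1 \<le> n \<Longrightarrow> distr M borel (\<xi> n) = distr M borel X"
    and lattice: "planar_lattice R"
    and walk_in_lattice: "AE \<omega> in M. \<forall>n. walk \<xi> n \<omega> \<in> R"
    and angle: "0 < \<alpha>" "\<alpha> \<le> pi"
    and exit_on_boundary: "\<And>x. x \<in> R \<inter> wedge \<alpha> \<Longrightarrow>
      AE \<omega> in M. \<exists>n. exit_time \<xi> (wedge \<alpha>) x \<omega> = enat n \<and>
        x + walk \<xi> n \<omega> \<in> frontier (wedge \<alpha>)"

definition killed_harmonic ::
  "'a measure \<Rightarrow> ('a \<Rightarrow> real^2) \<Rightarrow> (real^2) set \<Rightarrow> (real^2) set \<Rightarrow> (real^2 \<Rightarrow> real) \<Rightarrow> bool" where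
  "killed_harmonic M X R K f \<longleftrightarrow>
     (\<forall>x \<in> K \<inter> R.
        has_bochner_integral M (\<lambda>\<omega>. indicator K (x + X \<omega>) * f (x + X \<omega>)) (f x))"

section \<open>Expressions in the mixed moments\<close>

definition mixed_moment :: "'a measure \<Rightarrow> ('a \<Rightarrow> real^2) \<Rightarrow> nat \<Rightarrow> nat \<Rightarrow> real" where
  "mixed_moment M X k l = (\<integral>\<omega>. (X \<omega> $ 1) ^ k * (X \<omega> $ 2) ^ l \<partial>M)"

text \<open>
  A list of pairs \<open>(c, L)\<close> encodes a real polynomial in the unknowns
  \<open>\<mu> k l\<close>: the sum of the monomials \<open>c \<cdot> \<Prod>\<^bsub>(k, l) \<in> L\<^esub> \<mu> k l\<close>.
\<close>

type_synonym moment_poly = "(real \<times> (nat \<times> nat) list) list"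

definition eval_moment_poly :: "moment_poly \<Rightarrow> (nat \<Rightarrow> nat \<Rightarrow> real) \<Rightarrow> real" where
  "eval_moment_poly P \<mu> = (\<Sum>(c, L)\<leftarrow>P. c * (\<Prod>(k, l)\<leftarrow>L. \<mu> k l))"

definition order_less :: "moment_poly \<Rightarrow> nat \<Rightarrow> bool" where
  "order_less P m \<longleftrightarrow> (\<forall>(c, L) \<in> set P. \<forall>(k, l) \<in> set L. k + l < m)"

text \<open>
  The coefficients of \<open>p\<close> are the linear combinations of the moments \<open>\<mu> k l\<close> of order
  \<open>k + l \<le> m\<close> with scalars prescribed by \<open>\<Lambda>\<close>. If the scalars could be chosen after the
  moments, this would hold for every \<open>p\<close>, because \<open>\<mu> 0 0 = 1\<close>; so \<open>\<Lambda>\<close> is to be chosen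
  independently of the distribution. Constant scalars do not suffice from \<open>m = 4\<close> on:
  there the correction of degree \<open>m - 1\<close>, which is linear in the third moments, is
  itself averaged over a step, so that products of third moments occur. Hence the scalars
  are polynomials in the moments of order less than \<open>m\<close>.
\<close>

definition coeffs_by_moments ::
  "(nat \<Rightarrow> nat \<Rightarrow> nat \<Rightarrow> nat \<Rightarrow> moment_poly) \<Rightarrow> nat \<Rightarrow> (nat \<Rightarrow> nat \<Rightarrow> real) \<Rightarrow>
    real poly poly \<Rightarrow> bool" where
  "coeffs_by_moments \<Lambda> m \<mu> p \<longleftrightarrow>
     (\<forall>i j k l. order_less (\<Lambda> i j k l) m) \<and>
     (\<forall>i j. coeff2 p i j =
        (\<Sum>(k, l) \<in> {(k, l). k + l \<le> m}. eval_moment_poly (\<Lambda> i j k l) \<mu> * \<mu> k l))"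

end

theory Submission
  imports Defs
begin

text \<open>
  The step operator \<open>P h x = E h (x + X)\<close> acts on polynomials as \<open>1 + \<Delta>/2\<close> plus terms of
  order at least three, because the first and second moments of \<open>X\<close> are those of a standard
  Gaussian. A walk that leaves the wedge through its boundary does not feel the killing when \<open>h\<close>
  vanishes there, so on such functions harmonicity for the killed walk is \<open>P h = h\<close> on the
  lattice points of the wedge (\<open>killed_iff_free\<close>). Both parts are then statements about
  \<open>P - 1\<close>, graded by degree.

  Part (a). Start from \<open>u m\<close>, whose image under \<open>P - 1\<close> has degree at most \<open>m - 3\<close>, and remove
  the remaining error one degree at a time: an error term \<open>f\<close> of degree \<open>d - 2\<close> is cancelled by a
  homogeneous polynomial of degree \<open>d\<close> that solves \<open>\<Delta> c = - 2 f\<close> and vanishes on both rays.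
  The equation always has a homogeneous solution vanishing on the ray \<open>\<phi> = 0\<close>, and a multiple of
  \<open>r\<^sup>d sin (d \<phi>)\<close> repairs it on the ray \<open>\<phi> = \<pi>/m\<close>, since \<open>sin (d \<pi>/m) \<noteq> 0\<close> for
  \<open>0 < d < m\<close>. The construction runs through \<open>d = m - 1, \<dots>, 2\<close>. Moments of order \<open>m\<close> come up
  only in the very last step, linearly, which gives the dependence on the moments.

  Part (b). Write \<open>h (n v + X)\<close> as a polynomial in \<open>n\<close>. Harmonicity at all points \<open>n v\<close> of the ray
  through a lattice point \<open>v\<close> separates the coefficients, and the one of \<open>n ^ (m - 2)\<close> is
  quadratic in \<open>X\<close>: its mean says that the top part of \<open>h\<close> is a harmonic function, with no moments
  beyond the second involved (\<open>harmonic_top_laplace\<close>). Each of the two rays contains a nonzero lattice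
  point: otherwise lattice points of the wedge would come arbitrarily close to that edge, and a
  step of mean zero, which never crosses the edge, could have no component across it
  (\<open>lattice_point_on_edge\<close>). So the top part vanishes on both rays, and it inherits the sign of
  \<open>h\<close> in between. Vanishing at \<open>\<phi> = 0\<close> leaves \<open>B r\<^sup>m sin (m \<phi>)\<close>, vanishing at \<open>\<alpha>\<close> makes
  \<open>m \<alpha>\<close> a multiple of \<open>\<pi>\<close>, and the sign makes it \<open>\<pi>\<close> itself.
\<close>

section \<open>Polynomials as coefficient arrays\<close>

definition bivar :: "nat \<Rightarrow> (nat \<Rightarrow> nat \<Rightarrow> real) \<Rightarrow> real \<Rightarrow> real \<Rightarrow> real" where
  "bivar m c x y = (\<Sum>i\<le>m. \<Sum>j\<le>m. c i j * x ^ i * y ^ j)"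

definition hom_part :: "(nat \<Rightarrow> nat \<Rightarrow> real) \<Rightarrow> nat \<Rightarrow> real \<Rightarrow> real \<Rightarrow> real" where
  "hom_part c d x y = (\<Sum>i\<le>d. c i (d - i) * x ^ i * y ^ (d - i))"

definition degree_bound :: "nat \<Rightarrow> (nat \<Rightarrow> nat \<Rightarrow> real) \<Rightarrow> bool" where
  "degree_bound m c \<longleftrightarrow> (\<forall>i j. m < i + j \<longrightarrow> c i j = 0)"

definition laplace :: "(nat \<Rightarrow> nat \<Rightarrow> real) \<Rightarrow> nat \<Rightarrow> nat \<Rightarrow> real" where
  "laplace c a b = real ((a + 2) * (a + 1)) * c (a + 2) b + real ((b + 2) * (b + 1)) * c a (b + 2)"

definition shift_coeff :: "nat \<Rightarrow> (nat \<Rightarrow> nat \<Rightarrow> real) \<Rightarrow> real \<Rightarrow> real \<Rightarrow> nat \<Rightarrow> nat \<Rightarrow> real" where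
  "shift_coeff m c x y a b =
     (\<Sum>k\<le>m. \<Sum>l\<le>m. real ((a + k) choose k) * real ((b + l) choose l) * c (a + k) (b + l) * (x ^ k * y ^ l))"

lemma bivar_eq_sum_hom_part:
  assumes "degree_bound m c"
  shows "bivar m c x y = (\<Sum>d\<le>m. hom_part c d x y)"
proof -
  let ?g = "\<lambda>i j. c i j * x ^ i * y ^ j"
  have "bivar m c x y = (\<Sum>(i, j)\<in>{..m} \<times> {..m}. ?g i j)"
    unfolding bivar_def by (rule sum.cartesian_product)
  also have "\<dots> = (\<Sum>(i, j)\<in>{(i, j). i + j \<le> m}. ?g i j)"
    using assms by (intro sum.mono_neutral_right) (force simp: degree_bound_def not_le)+
  also have "\<dots> = (\<Sum>d\<le>m. \<Sum>i\<le>d. ?g i (d - i))"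
    by (rule sum.triangle_reindex_eq)
  finally show ?thesis by (simp add: hom_part_def)
qed

lemma hom_part_scale: "hom_part c d (t * x) (t * y) = t ^ d * hom_part c d x y"
  unfolding hom_part_def sum_distrib_left
  by (rule sum.cong) (auto simp: power_mult_distrib algebra_simps simp flip: power_add)

lemma binomial_shift_sum:
  fixes g :: "nat \<Rightarrow> real"
  assumes "\<And>i. m < i \<Longrightarrow> g i = 0"
  shows "(\<Sum>i\<le>m. g i * (x + y) ^ i) =
    (\<Sum>a\<le>m. \<Sum>k\<le>m. real ((a + k) choose k) * g (a + k) * x ^ a * y ^ k)"
proof -
  let ?F = "\<lambda>a k. real ((a + k) choose k) * g (a + k) * x ^ a * y ^ k"
  have "(\<Sum>a\<le>m. \<Sum>k\<le>m. ?F a k) = (\<Sum>(a, k)\<in>{..m} \<times> {..m}. ?F a k)"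
    by (rule sum.cartesian_product)
  also have "\<dots> = (\<Sum>(a, k)\<in>{(a, k). a + k \<le> m}. ?F a k)"
    by (intro sum.mono_neutral_right) (auto, metis assms not_le)
  also have "\<dots> = (\<Sum>i\<le>m. \<Sum>a\<le>i. ?F a (i - a))"
    by (rule sum.triangle_reindex_eq)
  also have "\<dots> = (\<Sum>i\<le>m. g i * (x + y) ^ i)"
  proof (rule sum.cong[OF refl])
    fix i
    show "(\<Sum>a\<le>i. ?F a (i - a)) = g i * (x + y) ^ i"
      unfolding binomial_ring sum_distrib_left
    proof (rule sum.cong[OF refl])
      fix a assume "a \<in> {..i}"
      then have "a \<le> i" by simp
      moreover from this have "i choose (i - a) = i choose a"
        by (rule binomial_symmetric[symmetric])
      ultimately show "?F a (i - a) = g i * (of_nat (i choose a) * x ^ a * y ^ (i - a))"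
        by simp
    qed
  qed
  finally show ?thesis by simp
qed

text \<open>
  Taylor expansion at \<open>(x, y)\<close> in powers of the increment \<open>(x', y')\<close>, regrouped by the powers of
  \<open>x\<close> and \<open>y\<close>. Averaging the increment then only concerns the coefficients.
\<close>

lemma bivar_shift:
  assumes "degree_bound m c"
  shows "bivar m c (x + x') (y + y') = bivar m (shift_coeff m c x' y') x y"
proof -
  define e where "e i b l = real ((b + l) choose l) * c i (b + l) * y ^ b * y' ^ l" for i b l
  have "bivar m c (x + x') (y + y') = (\<Sum>i\<le>m. (\<Sum>j\<le>m. c i j * (y + y') ^ j) * (x + x') ^ i)"
    by (simp add: bivar_def sum_distrib_left mult_ac)
  also have "\<dots> = (\<Sum>i\<le>m. (\<Sum>b\<le>m. \<Sum>l\<le>m. e i b l) * (x + x') ^ i)"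
    using assms by (subst binomial_shift_sum) (auto simp: degree_bound_def e_def)
  also have "\<dots> = (\<Sum>a\<le>m. \<Sum>k\<le>m. real ((a + k) choose k) * (\<Sum>b\<le>m. \<Sum>l\<le>m. e (a + k) b l) * x ^ a * x' ^ k)"
    using assms by (subst binomial_shift_sum) (auto simp: degree_bound_def e_def)
  also have "\<dots> = (\<Sum>a\<le>m. \<Sum>k\<le>m. \<Sum>b\<le>m. \<Sum>l\<le>m. real ((a + k) choose k) * e (a + k) b l * x ^ a * x' ^ k)"
    by (simp add: sum_distrib_left sum_distrib_right)
  also have "\<dots> = (\<Sum>a\<le>m. \<Sum>b\<le>m. \<Sum>k\<le>m. \<Sum>l\<le>m. real ((a + k) choose k) * e (a + k) b l * x ^ a * x' ^ k)"
    by (rule sum.cong[OF refl]) (rule sum.swap)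
  also have "\<dots> = bivar m (shift_coeff m c x' y') x y"
    by (simp add: bivar_def shift_coeff_def e_def sum_distrib_left sum_distrib_right mult_ac)
  finally show ?thesis .
qed

lemma degree_bound_shift:
  "degree_bound m c \<Longrightarrow> degree_bound m (shift_coeff m c x y)"
  by (auto simp: degree_bound_def shift_coeff_def)

lemma poly_eq_sum_coeff:
  fixes p :: "'c::comm_ring_1 poly"
  assumes "degree p \<le> n"
  shows "poly p x = (\<Sum>i\<le>n. coeff p i * x ^ i)"
  unfolding poly_altdef using assms
  by (intro sum.mono_neutral_left) (auto simp: coeff_eq_0 not_le)

lemma poly2_eq_bivar:
  assumes "total_degree_le p m"
  shows "poly2 p x = bivar m (coeff2 p) (x $ 1) (x $ 2)"
proof -
  have zero: "coeff (coeff p j) i = 0" if "m < i + j" for i j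
    using assms that unfolding total_degree_le_def coeff2_def by fastforce
  have deg_in: "degree (coeff p j) \<le> m" for j
    by (rule degree_le) (auto intro: zero)
  have deg_out: "degree p \<le> m"
    by (rule degree_le) (auto intro!: poly_eqI zero)
  have "poly2 p x = (\<Sum>j\<le>m. poly (coeff p j) (x $ 1) * (x $ 2) ^ j)"
    unfolding poly2_def
    by (subst poly_eq_sum_coeff[OF deg_out]) (simp add: poly_sum)
  also have "\<dots> = (\<Sum>j\<le>m. \<Sum>i\<le>m. coeff2 p i j * (x $ 1) ^ i * (x $ 2) ^ j)"
    by (simp add: poly_eq_sum_coeff[OF deg_in] sum_distrib_right coeff2_def)
  also have "\<dots> = bivar m (coeff2 p) (x $ 1) (x $ 2)"
    unfolding bivar_def by (rule sum.swap)
  finally show ?thesis .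
qed

definition poly_of_coeffs :: "nat \<Rightarrow> (nat \<Rightarrow> nat \<Rightarrow> real) \<Rightarrow> real poly poly" where
  "poly_of_coeffs m c = (\<Sum>j\<le>m. monom (\<Sum>i\<le>m. monom (c i j) i) j)"

lemma coeff2_poly_of_coeffs:
  assumes "degree_bound m c"
  shows "coeff2 (poly_of_coeffs m c) i j = c i j"
proof -
  have 1: "coeff (poly_of_coeffs m c) j = (if j \<le> m then (\<Sum>i\<le>m. monom (c i j) i) else 0)"
    unfolding poly_of_coeffs_def coeff_sum by simp
  show ?thesis
    using assms unfolding coeff2_def 1 by (auto simp: coeff_sum degree_bound_def)
qed

lemma total_degree_le_iff: "total_degree_le p m \<longleftrightarrow> degree_bound m (coeff2 p)"
  by (auto simp: total_degree_le_def degree_bound_def not_less[symmetric])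

lemma poly2_poly_of_coeffs:
  assumes "degree_bound m c"
  shows "poly2 (poly_of_coeffs m c) x = bivar m c (x $ 1) (x $ 2)"
    and "total_degree_le (poly_of_coeffs m c) m"
proof -
  have c: "coeff2 (poly_of_coeffs m c) = c"
    using coeff2_poly_of_coeffs[OF assms] by blast
  show "total_degree_le (poly_of_coeffs m c) m"
    unfolding total_degree_le_iff c by (rule assms)
  then show "poly2 (poly_of_coeffs m c) x = bivar m c (x $ 1) (x $ 2)"
    by (simp add: poly2_eq_bivar c)
qed

section \<open>Harmonic polynomials and the Dirichlet problem in the wedge\<close>

text \<open>
  Restricted to \<open>i + j = d\<close>, these are the coefficients of \<open>Im ((x + \<i> y) ^ d)\<close>. One array serves
  all degrees.
\<close>

definition u_coeff :: "nat \<Rightarrow> nat \<Rightarrow> real" where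
  "u_coeff i j = real ((i + j) choose i) * Im (\<i> ^ j)"

lemma Im_complex_of_real_mult: "Im (complex_of_real r * z) = r * Im z"
  by simp

lemma hom_part_u_coeff: "hom_part u_coeff d x y = Im (Complex x y ^ d)"
proof -
  have "Complex x y = complex_of_real x + \<i> * complex_of_real y"
    by (simp add: complex_eq_iff)
  then have "Im (Complex x y ^ d) =
    (\<Sum>i\<le>d. Im (of_nat (d choose i) * complex_of_real x ^ i * (\<i> * complex_of_real y) ^ (d - i)))"
    by (simp add: binomial_ring)
  also have "\<dots> = hom_part u_coeff d x y"
    unfolding hom_part_def
  proof (rule sum.cong[OF refl])
    fix i assume "i \<in> {..d}"
    have "of_nat (d choose i) * complex_of_real x ^ i * (\<i> * complex_of_real y) ^ (d - i) =
      complex_of_real (real (d choose i) * x ^ i * y ^ (d - i)) * \<i> ^ (d - i)"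
      by (simp add: power_mult_distrib mult_ac)
    then show "Im (of_nat (d choose i) * complex_of_real x ^ i * (\<i> * complex_of_real y) ^ (d - i)) =
       u_coeff i (d - i) * x ^ i * y ^ (d - i)"
      using \<open>i \<in> {..d}\<close> by (simp only: Im_complex_of_real_mult) (simp add: u_coeff_def)
  qed
  finally show ?thesis by simp
qed

lemma choose_two_steps:
  "(b + 2) * (b + 1) * ((a + (b + 2)) choose a) = (a + 2) * (a + 1) * ((a + 2 + b) choose (a + 2))"
proof -
  let ?n = "a + b + 2"
  have "fact a * fact (b + 2) * (?n choose a) = (fact ?n :: nat)"
    using binomial_fact_lemma[of a ?n] by simp
  moreover have "fact (a + 2) * fact b * (?n choose (a + 2)) = (fact ?n :: nat)"
    using binomial_fact_lemma[of "a + 2" ?n] by simp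
  ultimately have "fact a * fact b * ((b + 2) * (b + 1) * (?n choose a)) =
      fact a * fact b * ((a + 2) * (a + 1) * (?n choose (a + 2)))"
    by (simp add: fact_reduce algebra_simps)
  then show ?thesis by (simp add: add_ac)
qed

lemma laplace_u_coeff: "laplace u_coeff a b = 0"
proof -
  have "real ((b + 2) * (b + 1)) * real ((a + (b + 2)) choose a) =
      real ((a + 2) * (a + 1)) * real ((a + 2 + b) choose (a + 2))"
    using choose_two_steps[of b a] by (metis of_nat_mult)
  then show ?thesis
    unfolding laplace_def u_coeff_def by (simp add: power_add)
qed

text \<open>
  Harmonicity is a recursion in steps of two along the coefficients of a homogeneous polynomial, so
  a harmonic polynomial of degree \<open>d\<close> is determined by two of them. The coefficient of \<open>x\<^sup>d\<close> is its
  value on the ray \<open>\<phi> = 0\<close>; if that is zero, only the multiples of \<open>Im (z ^ d)\<close> remain.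
\<close>

lemma harmonic_coeffs_unique:
  assumes "\<And>a b. a + b + 2 = d \<Longrightarrow> laplace c a b = 0"
    and "c d 0 = 0" and "i + j = d"
  shows "c i j = c (d - 1) 1 / d * u_coeff i j"
  using assms(3)
proof (induction j arbitrary: i rule: induct_nat_012)
  case 0
  then show ?case using assms(2) by (simp add: u_coeff_def)
next
  case 1
  then have "d = Suc i" by simp
  then show ?case by (simp add: u_coeff_def)
next
  case (ge2 j)
  let ?B = "c (d - 1) 1 / d"
  have IH: "c (i + 2) j = ?B * u_coeff (i + 2) j"
    using ge2 by (intro ge2(1)) simp
  have "laplace c i j = 0" using ge2 by (intro assms(1)) simp
  moreover have "laplace u_coeff i j = 0" by (rule laplace_u_coeff)
  ultimately have "real ((j + 2) * (j + 1)) * c i (j + 2) =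
      real ((j + 2) * (j + 1)) * (?B * u_coeff i (j + 2))"
    unfolding laplace_def IH by algebra
  moreover have "real ((j + 2) * (j + 1)) \<noteq> 0"
    by (simp only: of_nat_eq_0_iff) simp
  ultimately show ?case
    by (simp only: mult_cancel_left) simp
qed

text \<open>
  The Poisson equation \<open>laplace c = f\<close>, read as a recursion for the coefficients with starting
  values zero. In particular the solution contains no pure power of \<open>x\<close>, that is, it vanishes on
  the ray \<open>\<phi> = 0\<close>.
\<close>

fun particular_solution :: "(nat \<Rightarrow> nat \<Rightarrow> real) \<Rightarrow> nat \<Rightarrow> nat \<Rightarrow> real" where
  "particular_solution f a 0 = 0"
| "particular_solution f a (Suc 0) = 0"
| "particular_solution f a (Suc (Suc b)) =
     (f a b - real ((a + 2) * (a + 1)) * particular_solution f (a + 2) b) / real ((b + 2) * (b + 1))"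

lemma laplace_particular_solution: "laplace (particular_solution f) a b = f a b"
proof -
  have "real ((b + 2) * (b + 1)) \<noteq> 0" by (simp del: of_nat_mult of_nat_add)
  then show ?thesis by (simp add: laplace_def del: of_nat_mult of_nat_add)
qed

text \<open>
  Subtracting a multiple of the harmonic polynomial \<open>r\<^sup>d sin (d \<phi>)\<close> in each degree \<open>d = i + j\<close>
  keeps the Laplacian and the zeros on the ray \<open>\<phi> = 0\<close>. The multiple is the one that produces a
  zero on the ray \<open>\<phi> = \<alpha>\<close>, as long as \<open>sin (d \<alpha>) \<noteq> 0\<close>.
\<close>

definition dirichlet_solution :: "real \<Rightarrow> (nat \<Rightarrow> nat \<Rightarrow> real) \<Rightarrow> nat \<Rightarrow> nat \<Rightarrow> real" where
  "dirichlet_solution \<alpha> f i j =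
     particular_solution f i j
     - hom_part (particular_solution f) (i + j) (cos \<alpha>) (sin \<alpha>) / sin (real (i + j) * \<alpha>) * u_coeff i j"

lemma laplace_dirichlet_solution: "laplace (dirichlet_solution \<alpha> f) a b = f a b"
proof -
  define B where "B = hom_part (particular_solution f) (a + b + 2) (cos \<alpha>) (sin \<alpha>) / sin (real (a + b + 2) * \<alpha>)"
  have *: "a + 2 + b = a + b + 2" "a + (b + 2) = a + b + 2" by simp_all
  have "laplace (dirichlet_solution \<alpha> f) a b = laplace (particular_solution f) a b - B * laplace u_coeff a b"
    unfolding laplace_def dirichlet_solution_def * B_def[symmetric] by algebra
  then show ?thesis by (simp add: laplace_particular_solution laplace_u_coeff)
qed

lemma hom_part_on_axis: "hom_part c d x 0 = c d 0 * x ^ d"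
proof -
  have "hom_part c d x 0 = (\<Sum>i\<le>d. if i = d then c d 0 * x ^ d else 0)"
    unfolding hom_part_def by (rule sum.cong) auto
  then show ?thesis by simp
qed

lemma u_coeff_ray: "hom_part u_coeff d (cos \<phi>) (sin \<phi>) = sin (real d * \<phi>)"
proof -
  have "Complex (cos \<phi>) (sin \<phi>) = cis \<phi>"
    by (simp add: complex_eq_iff)
  then have "Complex (cos \<phi>) (sin \<phi>) ^ d = cis (real d * \<phi>)"
    by (simp only: Complex.DeMoivre)
  then show ?thesis
    by (simp only: hom_part_u_coeff cis.sel)
qed

lemma dirichlet_solution_vanishes:
  assumes "sin (real d * \<alpha>) \<noteq> 0"
  shows "hom_part (dirichlet_solution \<alpha> f) d (cos \<alpha>) (sin \<alpha>) = 0"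
    and "dirichlet_solution \<alpha> f d 0 = 0"
proof -
  let ?B = "hom_part (particular_solution f) d (cos \<alpha>) (sin \<alpha>) / sin (real d * \<alpha>)"
  have "hom_part (dirichlet_solution \<alpha> f) d (cos \<alpha>) (sin \<alpha>) =
    hom_part (particular_solution f) d (cos \<alpha>) (sin \<alpha>) - ?B * hom_part u_coeff d (cos \<alpha>) (sin \<alpha>)"
    unfolding hom_part_def[of "dirichlet_solution \<alpha> f"] hom_part_def[of u_coeff]
      sum_distrib_left
    by (subst hom_part_def) (simp add: dirichlet_solution_def sum_subtractf[symmetric] algebra_simps)
  then show "hom_part (dirichlet_solution \<alpha> f) d (cos \<alpha>) (sin \<alpha>) = 0"
    using assms by (simp add: u_coeff_ray)
  show "dirichlet_solution \<alpha> f d 0 = 0"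
    by (simp add: dirichlet_solution_def u_coeff_def)
qed

section \<open>Functions of the moments\<close>

type_synonym moments = "nat \<Rightarrow> nat \<Rightarrow> real"

definition low_moment_fun :: "nat \<Rightarrow> (moments \<Rightarrow> real) \<Rightarrow> bool" where
  "low_moment_fun m F \<longleftrightarrow> (\<exists>P. order_less P m \<and> (\<forall>\<mu>. F \<mu> = eval_moment_poly P \<mu>))"

text \<open>
  The normalisation \<open>\<mu> 0 0 = 1\<close> turns every polynomial in the low moments into such a combination,
  with itself as the coefficient of \<open>\<mu> 0 0\<close>.
\<close>

definition moment_combination :: "nat \<Rightarrow> (moments \<Rightarrow> real) \<Rightarrow> bool" where
  "moment_combination m F \<longleftrightarrow>
     (\<exists>Q. (\<forall>k l. low_moment_fun m (Q k l)) \<and>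
          (\<forall>\<mu>. \<mu> 0 0 = 1 \<longrightarrow> F \<mu> = (\<Sum>(k, l) \<in> {(k, l). k + l \<le> m}. Q k l \<mu> * \<mu> k l)))"

text \<open>
  Solving the Dirichlet problem is linear in the data with coefficients that depend on the angle
  only. Any class of functions of the moments that is closed under linear combinations is therefore
  preserved by it; this applies to both classes above.
\<close>

definition linear_class :: "((moments \<Rightarrow> real) \<Rightarrow> bool) \<Rightarrow> bool" where
  "linear_class C \<longleftrightarrow> C (\<lambda>\<mu>. 0) \<and> (\<forall>a b F G. C F \<longrightarrow> C G \<longrightarrow> C (\<lambda>\<mu>. a * F \<mu> + b * G \<mu>))"

lemma linear_class_scale:
  assumes "linear_class C" "C F" shows "C (\<lambda>\<mu>. a * F \<mu>)"
proof -
  have "C (\<lambda>\<mu>. a * F \<mu> + 0 * F \<mu>)"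
    using assms unfolding linear_class_def by blast
  then show ?thesis by simp
qed

lemma linear_class_diff:
  assumes "linear_class C" "C F" "C G" shows "C (\<lambda>\<mu>. F \<mu> - G \<mu>)"
proof -
  have "C (\<lambda>\<mu>. 1 * F \<mu> + (-1) * G \<mu>)"
    using assms unfolding linear_class_def by blast
  then show ?thesis by simp
qed

lemma linear_class_sum:
  assumes "linear_class C" "finite I" "\<And>i. i \<in> I \<Longrightarrow> C (\<lambda>\<mu>. F \<mu> i)"
  shows "C (\<lambda>\<mu>. \<Sum>i\<in>I. F \<mu> i)"
  using assms(2,3)
proof (induction I rule: finite_induct)
  case empty
  then show ?case using assms(1) by (simp add: linear_class_def)
next
  case (insert i I)
  then have "C (\<lambda>\<mu>. F \<mu> i)" "C (\<lambda>\<mu>. \<Sum>i\<in>I. F \<mu> i)" by simp_all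
  then have "C (\<lambda>\<mu>. 1 * F \<mu> i + 1 * (\<Sum>i\<in>I. F \<mu> i))"
    using assms(1) unfolding linear_class_def by blast
  then show ?case using insert by simp
qed

lemma eval_moment_poly_append:
  "eval_moment_poly (P @ Q) \<mu> = eval_moment_poly P \<mu> + eval_moment_poly Q \<mu>"
  by (simp add: eval_moment_poly_def)

lemma eval_moment_poly_scale:
  "eval_moment_poly (map (\<lambda>(c, L). (a * c, L)) P) \<mu> = a * eval_moment_poly P \<mu>"
  by (induction P) (auto simp: eval_moment_poly_def algebra_simps)

lemma eval_moment_poly_times_moment:
  "eval_moment_poly (map (\<lambda>(c, L). (c, (k, l) # L)) P) \<mu> = eval_moment_poly P \<mu> * \<mu> k l"
  by (induction P) (auto simp: eval_moment_poly_def algebra_simps)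

lemma linear_class_low_moment_fun: "linear_class (low_moment_fun m)"
  unfolding linear_class_def
proof (intro conjI allI impI)
  show "low_moment_fun m (\<lambda>\<mu>. 0)"
    unfolding low_moment_fun_def
    by (rule exI[of _ "[]"]) (simp add: order_less_def eval_moment_poly_def)
  fix a b F G
  assume "low_moment_fun m F" "low_moment_fun m G"
  then obtain P Q where
      P: "order_less P m" "\<And>\<mu>. F \<mu> = eval_moment_poly P \<mu>"
    and Q: "order_less Q m" "\<And>\<mu>. G \<mu> = eval_moment_poly Q \<mu>"
    unfolding low_moment_fun_def by blast
  let ?S = "\<lambda>a. map (\<lambda>(c, L). (a * c, L))"
  show "low_moment_fun m (\<lambda>\<mu>. a * F \<mu> + b * G \<mu>)"
    unfolding low_moment_fun_def
  proof (intro exI[of _ "?S a P @ ?S b Q"] conjI allI)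
    show "order_less (?S a P @ ?S b Q) m"
      using P(1) Q(1) by (fastforce simp: order_less_def)
  qed (simp add: eval_moment_poly_append eval_moment_poly_scale P Q)
qed

lemma low_moment_fun_const: "low_moment_fun m (\<lambda>\<mu>. c)"
  unfolding low_moment_fun_def
  by (rule exI[of _ "[(c, [])]"]) (simp add: order_less_def eval_moment_poly_def)

lemma low_moment_fun_times_moment:
  assumes "low_moment_fun m F" "k + l < m"
  shows "low_moment_fun m (\<lambda>\<mu>. F \<mu> * \<mu> k l)"
proof -
  obtain P where P: "order_less P m" "\<And>\<mu>. F \<mu> = eval_moment_poly P \<mu>"
    using assms(1) unfolding low_moment_fun_def by blast
  show ?thesis
    unfolding low_moment_fun_def
  proof (intro exI[of _ "map (\<lambda>(c, L). (c, (k, l) # L)) P"] conjI allI)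
    show "order_less (map (\<lambda>(c, L). (c, (k, l) # L)) P) m"
      using P(1) assms(2) by (fastforce simp: order_less_def)
  qed (simp add: eval_moment_poly_times_moment P)
qed

lemma linear_class_moment_combination: "linear_class (moment_combination m)"
  unfolding linear_class_def
proof (intro conjI allI impI)
  show "moment_combination m (\<lambda>\<mu>. 0)"
    unfolding moment_combination_def
    by (rule exI[of _ "\<lambda>k l \<mu>. 0"]) (simp add: low_moment_fun_const)
  fix a b F G
  assume "moment_combination m F" "moment_combination m G"
  then obtain P Q where
      P: "\<And>k l. low_moment_fun m (P k l)"
        "\<And>\<mu>. \<mu> 0 0 = 1 \<Longrightarrow> F \<mu> = (\<Sum>(k, l) \<in> {(k, l). k + l \<le> m}. P k l \<mu> * \<mu> k l)"
    and Q: "\<And>k l. low_moment_fun m (Q k l)"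
        "\<And>\<mu>. \<mu> 0 0 = 1 \<Longrightarrow> G \<mu> = (\<Sum>(k, l) \<in> {(k, l). k + l \<le> m}. Q k l \<mu> * \<mu> k l)"
    unfolding moment_combination_def by blast
  show "moment_combination m (\<lambda>\<mu>. a * F \<mu> + b * G \<mu>)"
    unfolding moment_combination_def
  proof (intro exI[of _ "\<lambda>k l \<mu>. a * P k l \<mu> + b * Q k l \<mu>"] conjI allI impI)
    fix k l show "low_moment_fun m (\<lambda>\<mu>. a * P k l \<mu> + b * Q k l \<mu>)"
      using linear_class_low_moment_fun P(1) Q(1) unfolding linear_class_def by blast
  next
    fix \<mu> :: moments assume "\<mu> 0 0 = 1"
    then show "a * F \<mu> + b * G \<mu> =
        (\<Sum>(k, l)\<in>{(k, l). k + l \<le> m}. (a * P k l \<mu> + b * Q k l \<mu>) * \<mu> k l)"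
      by (simp add: P Q sum_distrib_left case_prod_unfold algebra_simps flip: sum.distrib)
  qed
qed

lemma finite_triangle: "finite {(k, l). k + l \<le> (m :: nat)}"
  by (rule finite_subset[of _ "{..m} \<times> {..m}"]) auto

lemma moment_combination_times_moment:
  assumes "low_moment_fun m F" "k + l \<le> m"
  shows "moment_combination m (\<lambda>\<mu>. F \<mu> * \<mu> k l)"
  unfolding moment_combination_def
proof (intro exI[of _ "\<lambda>k' l' \<mu>. if (k', l') = (k, l) then F \<mu> else 0"] conjI allI impI)
  fix k' l'
  show "low_moment_fun m (\<lambda>\<mu>. if (k', l') = (k, l) then F \<mu> else 0)"
    using assms(1) low_moment_fun_const[of m 0] by (cases "(k', l') = (k, l)") auto
next
  fix \<mu> :: moments
  have "(\<Sum>(k', l')\<in>{(k, l). k + l \<le> m}. (if (k', l') = (k, l) then F \<mu> else 0) * \<mu> k' l') =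
      (\<Sum>p\<in>{(k, l). k + l \<le> m}. if p = (k, l) then F \<mu> * \<mu> k l else 0)"
    by (rule sum.cong) (auto split: if_splits)
  then show "F \<mu> * \<mu> k l =
      (\<Sum>(k', l')\<in>{(k, l). k + l \<le> m}. (if (k', l') = (k, l) then F \<mu> else 0) * \<mu> k' l')"
    using assms(2) by (simp add: finite_triangle)
qed

lemma moment_combination_cong:
  assumes "moment_combination m F" "\<And>\<mu>. \<mu> 0 0 = 1 \<Longrightarrow> G \<mu> = F \<mu>"
  shows "moment_combination m G"
  using assms unfolding moment_combination_def by auto

lemma low_moment_fun_imp_combination:
  assumes "low_moment_fun m F"
  shows "moment_combination m F"
  using moment_combination_times_moment[OF assms, of 0 0] by (rule moment_combination_cong) simp_all

section \<open>Correcting u degree by degree\<close>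

text \<open>
  The coefficient of \<open>x\<^sup>a y\<^sup>b\<close> in what moments of order at least three contribute to \<open>P - 1\<close>. Moments
  of orders one and two contribute \<open>laplace c a b / 2\<close>, see \<open>expectation_shift_coeff\<close> below.
\<close>

definition moment_source :: "nat \<Rightarrow> moments \<Rightarrow> (nat \<Rightarrow> nat \<Rightarrow> real) \<Rightarrow> nat \<Rightarrow> nat \<Rightarrow> real" where
  "moment_source m \<mu> c a b =
     (\<Sum>(k, l)\<in>{(k, l) \<in> {..m} \<times> {..m}. 3 \<le> k + l}.
        real ((a + k) choose k) * real ((b + l) choose l) * c (a + k) (b + l) * \<mu> k l)"

text \<open>
  \<open>corrected_u m \<alpha> \<mu> e\<close> is \<open>u m\<close> with corrections in the degrees from \<open>m - 1\<close> down to \<open>m - e\<close>. The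
  Laplacian of the next correction has the degree of the leading error that is left, and cancels
  it; everything else that the correction contributes has lower degree.
\<close>

primrec corrected_u :: "nat \<Rightarrow> real \<Rightarrow> moments \<Rightarrow> nat \<Rightarrow> nat \<Rightarrow> nat \<Rightarrow> real" where
  "corrected_u m \<alpha> \<mu> 0 = (\<lambda>i j. if i + j = m then u_coeff i j else 0)"
| "corrected_u m \<alpha> \<mu> (Suc e) = (\<lambda>i j.
     if i + j = m - Suc e
     then dirichlet_solution \<alpha> (\<lambda>a b. - 2 * moment_source m \<mu> (corrected_u m \<alpha> \<mu> e) a b) i j
     else corrected_u m \<alpha> \<mu> e i j)"

lemma corrected_u_support:
  assumes "e \<le> m" "corrected_u m \<alpha> \<mu> e i j \<noteq> 0"
  shows "m - e \<le> i + j \<and> i + j \<le> m"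
  using assms by (induction e) (auto split: if_splits)

lemma corrected_u_top:
  assumes "e \<le> m" "i + j = m"
  shows "corrected_u m \<alpha> \<mu> e i j = u_coeff i j"
  using assms by (induction e) auto

lemma degree_bound_corrected_u: "e \<le> m \<Longrightarrow> degree_bound m (corrected_u m \<alpha> \<mu> e)"
  using corrected_u_support by (fastforce simp: degree_bound_def)

lemma moment_source_cong:
  assumes "\<And>i j. a + b + 3 \<le> i + j \<Longrightarrow> c i j = c' i j"
  shows "moment_source m \<mu> c a b = moment_source m \<mu> c' a b"
  unfolding moment_source_def using assms by (intro sum.cong) auto

lemma laplace_cong:
  assumes "\<And>i j. i + j = a + b + 2 \<Longrightarrow> c i j = c' i j"
  shows "laplace c a b = laplace c' a b"
  unfolding laplace_def using assms by simp

text \<open>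
  A correction in degree \<open>d\<close> affects the error in degree \<open>d - 2\<close> and below, so what earlier
  corrections have cancelled stays cancelled. For \<open>e = m - 2\<close> no error is left.
\<close>

lemma laplace_corrected_u:
  assumes "e + 2 \<le> m" "m \<le> a + b + 2 + e"
  shows "laplace (corrected_u m \<alpha> \<mu> e) a b = - 2 * moment_source m \<mu> (corrected_u m \<alpha> \<mu> e) a b"
  using assms
proof (induction e arbitrary: a b)
  case 0
  have "laplace (corrected_u m \<alpha> \<mu> 0) a b = 0"
  proof (cases "a + b + 2 = m")
    case True
    then have "laplace (corrected_u m \<alpha> \<mu> 0) a b = laplace u_coeff a b"
      by (intro laplace_cong) simp
    then show ?thesis by (simp add: laplace_u_coeff)
  next
    case False
    then show ?thesis by (simp add: laplace_def)
  qed
  moreover have "moment_source m \<mu> (corrected_u m \<alpha> \<mu> 0) a b = 0"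
    using 0 unfolding moment_source_def by (intro sum.neutral) auto
  ultimately show ?case by simp
next
  case (Suc e)
  have source: "moment_source m \<mu> (corrected_u m \<alpha> \<mu> (Suc e)) a b = moment_source m \<mu> (corrected_u m \<alpha> \<mu> e) a b"
    using Suc.prems by (intro moment_source_cong) auto
  show ?case
  proof (cases "a + b + 2 = m - Suc e")
    case True
    then have "laplace (corrected_u m \<alpha> \<mu> (Suc e)) a b =
        laplace (dirichlet_solution \<alpha> (\<lambda>a b. - 2 * moment_source m \<mu> (corrected_u m \<alpha> \<mu> e) a b)) a b"
      by (intro laplace_cong) simp
    then show ?thesis unfolding source laplace_dirichlet_solution .
  next
    case False
    then have "laplace (corrected_u m \<alpha> \<mu> (Suc e)) a b = laplace (corrected_u m \<alpha> \<mu> e) a b"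
      by (intro laplace_cong) simp
    moreover have "e + 2 \<le> m" "m \<le> a + b + 2 + e"
      using False Suc.prems by linarith+
    ultimately show ?thesis unfolding source using False Suc.prems by (simp only: Suc.IH)
  qed
qed

lemma hom_part_cong:
  assumes "\<And>i j. i + j = d \<Longrightarrow> c i j = c' i j"
  shows "hom_part c d = hom_part c' d"
  unfolding hom_part_def using assms by (intro ext sum.cong) auto

lemma sin_less_pi_multiple:
  assumes "0 < d" "d < m"
  shows "sin (real d * (pi / real m)) \<noteq> 0"
proof -
  have "0 < real d * (pi / real m)" using assms by simp
  moreover have "real d * (pi / real m) < pi" using assms by (simp add: field_simps)
  ultimately show ?thesis using sin_gt_zero by fastforce
qed

lemma corrected_u_vanishes:
  assumes "e < m"
  shows "hom_part (corrected_u m (pi / m) \<mu> e) d (cos (pi / m)) (sin (pi / m)) = 0 \<and>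
    corrected_u m (pi / m) \<mu> e d 0 = 0"
  using assms
proof (induction e)
  case 0
  show ?case
  proof (cases "d = m")
    case True
    then have "hom_part (corrected_u m (pi / m) \<mu> 0) d = hom_part u_coeff d"
      by (intro hom_part_cong) simp
    then show ?thesis using True 0 by (simp add: u_coeff_ray) (simp add: u_coeff_def)
  next
    case False
    then show ?thesis by (simp add: hom_part_def)
  qed
next
  case (Suc e)
  show ?case
  proof (cases "d = m - Suc e")
    case True
    let ?D = "dirichlet_solution (pi / m) (\<lambda>a b. - 2 * moment_source m \<mu> (corrected_u m (pi / m) \<mu> e) a b)"
    have "sin (real d * (pi / real m)) \<noteq> 0"
      using True Suc.prems by (intro sin_less_pi_multiple) auto
    note * = dirichlet_solution_vanishes[OF this]
    have "hom_part (corrected_u m (pi / m) \<mu> (Suc e)) d = hom_part ?D d"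
      using True by (intro hom_part_cong) simp
    then show ?thesis using True * by simp
  next
    case False
    then have "hom_part (corrected_u m (pi / m) \<mu> (Suc e)) d = hom_part (corrected_u m (pi / m) \<mu> e) d"
      by (intro hom_part_cong) simp
    then show ?thesis using Suc False by simp
  qed
qed

lemma particular_solution_class:
  assumes "linear_class C" and "\<And>a b. a + b + 2 = d \<Longrightarrow> C (\<lambda>\<mu>. f \<mu> a b)"
    and "i + j = d"
  shows "C (\<lambda>\<mu>. particular_solution (f \<mu>) i j)"
  using assms(3)
proof (induction j arbitrary: i rule: induct_nat_012)
  case (ge2 j)
  have "C (\<lambda>\<mu>. f \<mu> i j)" using ge2 by (intro assms(2)) simp
  moreover have "C (\<lambda>\<mu>. particular_solution (f \<mu>) (i + 2) j)" using ge2 by (intro ge2(1)) simp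
  ultimately have
    "C (\<lambda>\<mu>. inverse (real ((j + 2) * (j + 1))) *
      (f \<mu> i j - real ((i + 2) * (i + 1)) * particular_solution (f \<mu>) (i + 2) j))"
    by (intro linear_class_scale[OF assms(1)] linear_class_diff[OF assms(1)])
  then show ?case by (simp add: divide_inverse mult.commute del: of_nat_mult of_nat_add)
qed (use assms(1) in \<open>simp_all add: linear_class_def\<close>)

lemma dirichlet_solution_class:
  assumes "linear_class C" and "\<And>a b. a + b + 2 = d \<Longrightarrow> C (\<lambda>\<mu>. f \<mu> a b)"
    and "i + j = d"
  shows "C (\<lambda>\<mu>. dirichlet_solution \<alpha> (f \<mu>) i j)"
proof -
  have part: "C (\<lambda>\<mu>. particular_solution (f \<mu>) i j)" if "i + j = d" for i j
    using particular_solution_class[OF assms(1) _ that, of f] assms(2) by blast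
  have S: "C (\<lambda>\<mu>. \<Sum>k\<le>d. (cos \<alpha> ^ k * sin \<alpha> ^ (d - k)) * particular_solution (f \<mu>) k (d - k))"
    by (intro linear_class_sum[OF assms(1)] linear_class_scale[OF assms(1)] part) auto
  have "C (\<lambda>\<mu>. particular_solution (f \<mu>) i j - (u_coeff i j / sin (real d * \<alpha>)) *
      (\<Sum>k\<le>d. (cos \<alpha> ^ k * sin \<alpha> ^ (d - k)) * particular_solution (f \<mu>) k (d - k)))"
    by (intro linear_class_diff[OF assms(1)] linear_class_scale[OF assms(1)] part assms(3) S)
  then show ?thesis
    unfolding dirichlet_solution_def hom_part_def assms(3) by (simp add: mult_ac)
qed

lemma moment_source_class:
  assumes "linear_class C" and "\<And>k l. 3 \<le> k + l \<Longrightarrow> C (\<lambda>\<mu>. c \<mu> (a + k) (b + l) * \<mu> k l)"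
  shows "C (\<lambda>\<mu>. moment_source m \<mu> (c \<mu>) a b)"
proof -
  let ?I = "{(k, l) \<in> {..m} \<times> {..m}. 3 \<le> k + l}"
  have "finite ?I" by (rule finite_subset[of _ "{..m} \<times> {..m}"]) auto
  then have "C (\<lambda>\<mu>. \<Sum>p\<in>?I. (real ((a + fst p) choose fst p) * real ((b + snd p) choose snd p)) *
      (c \<mu> (a + fst p) (b + snd p) * \<mu> (fst p) (snd p)))"
    by (intro linear_class_sum[OF assms(1)] linear_class_scale[OF assms(1)] assms(2)) auto
  then show ?thesis
    by (simp add: moment_source_def case_prod_unfold mult.assoc)
qed

text \<open>
  An error term of degree \<open>d - 2\<close> couples a coefficient in degree at most \<open>m\<close> with moments of order
  at most \<open>m - d + 2\<close>, which is below \<open>m\<close> as long as \<open>d \<ge> 3\<close>.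
\<close>

lemma corrected_u_low_moment:
  assumes "e + 3 \<le> m \<or> e = 0"
  shows "low_moment_fun m (\<lambda>\<mu>. corrected_u m \<alpha> \<mu> e i j)"
  using assms
proof (induction e arbitrary: i j)
  case 0
  show ?case by (simp add: low_moment_fun_const)
next
  case (Suc e)
  then have IH: "low_moment_fun m (\<lambda>\<mu>. corrected_u m \<alpha> \<mu> e i j)" for i j by simp
  have source: "low_moment_fun m (\<lambda>\<mu>. - 2 * moment_source m \<mu> (corrected_u m \<alpha> \<mu> e) a b)"
    if "a + b + 2 = m - Suc e" for a b
  proof (intro linear_class_scale[OF linear_class_low_moment_fun]
      moment_source_class[OF linear_class_low_moment_fun])
    fix k l
    show "low_moment_fun m (\<lambda>\<mu>. corrected_u m \<alpha> \<mu> e (a + k) (b + l) * \<mu> k l)"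
    proof (cases "k + l < m")
      case True
      then show ?thesis by (intro low_moment_fun_times_moment IH)
    next
      case False
      then have "corrected_u m \<alpha> \<mu> e (a + k) (b + l) = 0" for \<mu>
        using corrected_u_support[of e m \<alpha> \<mu> "a + k" "b + l"] that Suc.prems by fastforce
      then show ?thesis by (simp add: low_moment_fun_const)
    qed
  qed
  show ?case
  proof (cases "i + j = m - Suc e")
    case True
    have "low_moment_fun m (\<lambda>\<mu>. dirichlet_solution \<alpha>
        (\<lambda>a b. - 2 * moment_source m \<mu> (corrected_u m \<alpha> \<mu> e) a b) i j)"
      by (rule dirichlet_solution_class[OF linear_class_low_moment_fun _ True]) (rule source)
    then show ?thesis using True by simp
  next
    case False
    then show ?thesis using IH by simp
  qed
qed

text \<open>
  In the last correction, of degree two, moments of order \<open>m\<close> appear for the first time. The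
  coefficients they are multiplied with come from earlier steps and are free of them.
\<close>

lemma corrected_u_combination:
  assumes "2 \<le> m"
  shows "moment_combination m (\<lambda>\<mu>. corrected_u m \<alpha> \<mu> (m - 2) i j)"
proof (cases "m = 2")
  case True
  then show ?thesis
    by (auto intro!: low_moment_fun_imp_combination low_moment_fun_const)
next
  case False
  define e where "e = m - 3"
  have m: "m = e + 3" "m - 2 = Suc e" using assms False by (auto simp: e_def)
  have low: "low_moment_fun m (\<lambda>\<mu>. corrected_u m \<alpha> \<mu> e i j)" for i j
    using m by (intro corrected_u_low_moment) simp
  have source: "moment_combination m (\<lambda>\<mu>. - 2 * moment_source m \<mu> (corrected_u m \<alpha> \<mu> e) a b)" for a b
  proof (intro linear_class_scale[OF linear_class_moment_combination]
      moment_source_class[OF linear_class_moment_combination])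
    fix k l
    show "moment_combination m (\<lambda>\<mu>. corrected_u m \<alpha> \<mu> e (a + k) (b + l) * \<mu> k l)"
    proof (cases "k + l \<le> m")
      case True
      then show ?thesis by (intro moment_combination_times_moment low)
    next
      case False
      then have "corrected_u m \<alpha> \<mu> e (a + k) (b + l) = 0" for \<mu>
        using corrected_u_support[of e m \<alpha> \<mu> "a + k" "b + l"] m by fastforce
      then show ?thesis by (simp add: low_moment_fun_imp_combination low_moment_fun_const)
    qed
  qed
  show ?thesis
  proof (cases "i + j = 2")
    case True
    have "moment_combination m (\<lambda>\<mu>. dirichlet_solution \<alpha>
        (\<lambda>a b. - 2 * moment_source m \<mu> (corrected_u m \<alpha> \<mu> e) a b) i j)"
      by (rule dirichlet_solution_class[OF linear_class_moment_combination _ True]) (rule source)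
    then show ?thesis using True m by simp
  next
    case False
    then show ?thesis using low m by (simp add: low_moment_fun_imp_combination)
  qed
qed

lemma moment_combination_scalars:
  assumes "\<And>i j. moment_combination m (\<lambda>\<mu>. F \<mu> i j)"
  shows "\<exists>\<Lambda>. \<forall>\<mu> p. \<mu> 0 0 = 1 \<longrightarrow> (\<forall>i j. coeff2 p i j = F \<mu> i j) \<longrightarrow> coeffs_by_moments \<Lambda> m \<mu> p"
proof -
  have "\<forall>i j. \<exists>Q. (\<forall>k l. low_moment_fun m (Q k l)) \<and>
      (\<forall>\<mu>. \<mu> 0 0 = 1 \<longrightarrow> F \<mu> i j = (\<Sum>(k, l) \<in> {(k, l). k + l \<le> m}. Q k l \<mu> * \<mu> k l))"
    using assms unfolding moment_combination_def by simp
  then obtain Q where Q: "\<And>i j k l. low_moment_fun m (Q i j k l)"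
    "\<And>i j \<mu>. \<mu> 0 0 = 1 \<Longrightarrow> F \<mu> i j = (\<Sum>(k, l) \<in> {(k, l). k + l \<le> m}. Q i j k l \<mu> * \<mu> k l)"
    unfolding choice_iff by blast
  have "\<forall>i j k l. \<exists>P. order_less P m \<and> (\<forall>\<mu>. Q i j k l \<mu> = eval_moment_poly P \<mu>)"
    using Q(1) unfolding low_moment_fun_def by simp
  then obtain \<Lambda> where "\<And>i j k l. order_less (\<Lambda> i j k l) m"
      "\<And>i j k l \<mu>. Q i j k l \<mu> = eval_moment_poly (\<Lambda> i j k l) \<mu>"
    unfolding choice_iff by blast
  then show ?thesis
    using Q(2) unfolding coeffs_by_moments_def by (intro exI[of _ \<Lambda>]) simp
qed

section \<open>The wedge as an intersection of half-planes\<close>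

definition edge_normal :: "real \<Rightarrow> real^2" where
  "edge_normal \<alpha> = vector [sin \<alpha>, - cos \<alpha>]"

lemma inner_real2: "(x :: real^2) \<bullet> y = x $ 1 * y $ 1 + x $ 2 * y $ 2"
  by (simp add: inner_vec_def sum_2)

lemma inner_edge_normal: "edge_normal \<alpha> \<bullet> x = sin \<alpha> * x $ 1 - cos \<alpha> * x $ 2"
  by (simp add: inner_real2 edge_normal_def)

lemma inner_axis2: "axis 2 1 \<bullet> (x :: real^2) = x $ 2"
  by (simp add: inner_real2 axis_def)

lemma wedge_eq:
  assumes "0 < \<alpha>" "\<alpha> < pi"
  shows "wedge \<alpha> = {x. 0 < axis 2 1 \<bullet> x \<and> 0 < edge_normal \<alpha> \<bullet> x}"
proof (intro set_eqI iffI)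
  fix x assume "x \<in> wedge \<alpha>"
  then obtain r \<phi> where x: "x = vector [r * cos \<phi>, r * sin \<phi>]" and r: "0 < r" "0 < \<phi>" "\<phi> < \<alpha>"
    unfolding wedge_def by blast
  have "0 < r * sin \<phi>" using r assms by (intro mult_pos_pos sin_gt_zero) auto
  moreover have "0 < r * sin (\<alpha> - \<phi>)" using r assms by (intro mult_pos_pos sin_gt_zero) auto
  ultimately show "x \<in> {x. 0 < axis 2 1 \<bullet> x \<and> 0 < edge_normal \<alpha> \<bullet> x}"
    by (simp add: x inner_axis2 inner_edge_normal sin_diff algebra_simps)
next
  fix x assume "x \<in> {x. 0 < axis 2 1 \<bullet> x \<and> 0 < edge_normal \<alpha> \<bullet> x}"
  then have x: "0 < x $ 2" "0 < sin \<alpha> * x $ 1 - cos \<alpha> * x $ 2"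
    by (simp_all add: inner_axis2 inner_edge_normal)
  define z where "z = Complex (x $ 1) (x $ 2)"
  define r where "r = cmod z"
  define \<phi> where "\<phi> = Arg z"
  have z0: "z \<noteq> 0" using x(1) by (auto simp: z_def complex_eq_iff)
  then have r: "0 < r" by (simp add: r_def)
  have "z = of_real r * cis \<phi>"
    using z0 by (simp add: r_def \<phi>_def cis_Arg sgn_eq)
  then have x12: "x $ 1 = r * cos \<phi>" "x $ 2 = r * sin \<phi>"
    by (auto simp: z_def complex_eq_iff)
  have "0 < sin \<phi>" using x(1) r x12 by (simp add: zero_less_mult_iff)
  have range: "- pi < \<phi>" "\<phi> \<le> pi" using Arg_bounded[of z] by (simp_all add: \<phi>_def)
  have phi0: "0 < \<phi>"
  proof (rule ccontr)
    assume "\<not> 0 < \<phi>"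
    then have "0 \<le> sin (- \<phi>)" using range by (intro sin_ge_zero) auto
    then show False using \<open>0 < sin \<phi>\<close> by simp
  qed
  have "0 < r * sin (\<alpha> - \<phi>)" using x(2) by (simp add: x12 sin_diff algebra_simps)
  then have "0 < sin (\<alpha> - \<phi>)" using r by (simp add: zero_less_mult_iff)
  have "\<phi> < \<alpha>"
  proof (rule ccontr)
    assume "\<not> \<phi> < \<alpha>"
    then have "0 \<le> sin (\<phi> - \<alpha>)" using range assms by (intro sin_ge_zero) auto
    then show False using \<open>0 < sin (\<alpha> - \<phi>)\<close> sin_minus[of "\<alpha> - \<phi>"] by simp
  qed
  have "x = vector [r * cos \<phi>, r * sin \<phi>]"
    by (simp add: vec_eq_iff forall_2 x12)
  then show "x \<in> wedge \<alpha>"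
    unfolding wedge_def using r phi0 \<open>\<phi> < \<alpha>\<close> by blast
qed

lemma wedge_cone: "x \<in> wedge \<alpha> \<Longrightarrow> 0 < t \<Longrightarrow> t *\<^sub>R x \<in> wedge \<alpha>"
proof -
  assume "x \<in> wedge \<alpha>" "0 < t"
  then obtain r \<phi> where x: "x = vector [r * cos \<phi>, r * sin \<phi>]" "0 < r" "0 < \<phi>" "\<phi> < \<alpha>"
    unfolding wedge_def by blast
  then have "t *\<^sub>R x = vector [(t * r) * cos \<phi>, (t * r) * sin \<phi>]" "0 < t * r"
    using \<open>0 < t\<close> by (simp_all add: vec_eq_iff forall_2)
  then show "t *\<^sub>R x \<in> wedge \<alpha>"
    unfolding wedge_def using x by blast
qed

lemma wedge_nonempty: "0 < \<alpha> \<Longrightarrow> wedge \<alpha> \<noteq> {}"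
proof -
  assume "0 < \<alpha>"
  then have "vector [1 * cos (\<alpha> / 2), 1 * sin (\<alpha> / 2)] \<in> wedge \<alpha>"
    unfolding wedge_def by (intro CollectI exI[of _ 1] exI[of _ "\<alpha> / 2"]) simp
  then show ?thesis by blast
qed

lemma open_wedge: "0 < \<alpha> \<Longrightarrow> \<alpha> < pi \<Longrightarrow> open (wedge \<alpha>)"
  by (auto simp: wedge_eq intro!: open_Collect_conj open_Collect_less continuous_intros)

lemma closure_wedge:
  assumes "0 < \<alpha>" "\<alpha> < pi"
  shows "closure (wedge \<alpha>) = {x. 0 \<le> axis 2 1 \<bullet> x \<and> 0 \<le> edge_normal \<alpha> \<bullet> x}"
proof
  show "closure (wedge \<alpha>) \<subseteq> {x. 0 \<le> axis 2 1 \<bullet> x \<and> 0 \<le> edge_normal \<alpha> \<bullet> x}"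
    using assms
    by (intro closure_minimal) (auto simp: wedge_eq intro!: closed_Collect_conj closed_Collect_le continuous_intros)
  show "{x. 0 \<le> axis 2 1 \<bullet> x \<and> 0 \<le> edge_normal \<alpha> \<bullet> x} \<subseteq> closure (wedge \<alpha>)"
  proof
    fix x assume x: "x \<in> {x. 0 \<le> axis 2 1 \<bullet> x \<and> 0 \<le> edge_normal \<alpha> \<bullet> x}"
    obtain p where p: "p \<in> wedge \<alpha>" using wedge_nonempty assms by blast
    have "x + (1 / Suc n) *\<^sub>R p \<in> wedge \<alpha>" for n
      using x p by (auto simp: wedge_eq[OF assms] inner_add_right intro!: add_nonneg_pos)
    moreover have "(\<lambda>n. x + (1 / Suc n) *\<^sub>R p) \<longlonglongrightarrow> x + 0 *\<^sub>R p"
      by (intro tendsto_intros LIMSEQ_Suc[OF lim_1_over_n])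
    ultimately show "x \<in> closure (wedge \<alpha>)"
      unfolding closure_sequential by (intro exI[of _ "\<lambda>n. x + (1 / Suc n) *\<^sub>R p"]) simp
  qed
qed

lemma frontier_wedge:
  assumes "0 < \<alpha>" "\<alpha> < pi"
  shows "frontier (wedge \<alpha>) = closure (wedge \<alpha>) - wedge \<alpha>"
  using open_wedge[OF assms] by (simp add: frontier_def interior_open)

text \<open>
  Boundary values are checked one degree at a time: on a ray a homogeneous polynomial is a multiple
  of a power of the radius.
\<close>

lemma bivar_zero_on_frontier:
  assumes "0 < \<alpha>" "\<alpha> < pi" and "degree_bound m c"
    and "\<And>d. c d 0 = 0" and "\<And>d. hom_part c d (cos \<alpha>) (sin \<alpha>) = 0"
    and "x \<in> frontier (wedge \<alpha>)"
  shows "bivar m c (x $ 1) (x $ 2) = 0"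
proof -
  have s: "0 < sin \<alpha>" using assms by (intro sin_gt_zero)
  have "x $ 2 = 0 \<or> sin \<alpha> * x $ 1 = cos \<alpha> * x $ 2"
    using assms(6) unfolding frontier_wedge[OF assms(1,2)] closure_wedge[OF assms(1,2)]
    by (auto simp: wedge_eq[OF assms(1,2)] inner_axis2 inner_edge_normal)
  then show ?thesis
  proof
    assume "x $ 2 = 0"
    then show ?thesis
      by (simp add: bivar_eq_sum_hom_part[OF assms(3)] hom_part_on_axis assms(4))
  next
    assume *: "sin \<alpha> * x $ 1 = cos \<alpha> * x $ 2"
    define r where "r = x $ 2 / sin \<alpha>"
    have "x $ 1 = r * cos \<alpha>" "x $ 2 = r * sin \<alpha>"
      using s * by (simp_all add: r_def field_simps)
    then show ?thesis
      by (simp add: bivar_eq_sum_hom_part[OF assms(3)] hom_part_scale assms(5))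
  qed
qed

section \<open>Lattice points in cones and near edges\<close>

lemma lattice_combination:
  assumes "planar_lattice R" "x \<in> R" "y \<in> R"
  shows "of_int a *\<^sub>R x + of_int b *\<^sub>R y \<in> R"
proof -
  obtain v w where R: "R = {of_int a *\<^sub>R v + of_int b *\<^sub>R w | a b :: int. True}"
    using assms(1) unfolding planar_lattice_def by blast
  obtain i j k l :: int where
    "x = of_int i *\<^sub>R v + of_int j *\<^sub>R w" "y = of_int k *\<^sub>R v + of_int l *\<^sub>R w"
    using assms(2,3) unfolding R by blast
  then have "of_int a *\<^sub>R x + of_int b *\<^sub>R y =
      of_int (a * i + b * k) *\<^sub>R v + of_int (a * j + b * l) *\<^sub>R w"
    by (simp add: algebra_simps)
  then show ?thesis unfolding R by blast
qed

lemma lattice_add: "planar_lattice R \<Longrightarrow> x \<in> R \<Longrightarrow> y \<in> R \<Longrightarrow> x + y \<in> R"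
  using lattice_combination[of R x y 1 1] by simp

lemma lattice_scale: "planar_lattice R \<Longrightarrow> x \<in> R \<Longrightarrow> of_int a *\<^sub>R x \<in> R"
  using lattice_combination[of R x x a 0] by simp

lemma countable_lattice:
  assumes "planar_lattice R" shows "countable R"
proof -
  obtain v w where "R = {of_int a *\<^sub>R v + of_int b *\<^sub>R w | a b :: int. True}"
    using assms(1) unfolding planar_lattice_def by blast
  then have "R = (\<lambda>(a, b). of_int a *\<^sub>R v + of_int b *\<^sub>R w) ` (UNIV :: (int \<times> int) set)"
    by auto
  then show ?thesis by simp
qed

text \<open>
  Rational combinations of the generators are dense, and clearing denominators stays in the cone.
\<close>

lemma lattice_meets_open_cone:
  assumes R: "planar_lattice R" and U: "open U" "U \<noteq> {}"
    and cone: "\<And>x t. x \<in> U \<Longrightarrow> 0 < t \<Longrightarrow> t *\<^sub>R x \<in> U"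
  shows "\<exists>x\<in>R. x \<in> U"
proof -
  obtain v w where vw: "v \<noteq> w" "independent {v, w}"
    and R: "R = {of_int a *\<^sub>R v + of_int b *\<^sub>R w | a b :: int. True}"
    using R unfolding planar_lattice_def by blast
  obtain p where p: "p \<in> U" using U by blast
  obtain e where e: "0 < e" "ball p e \<subseteq> U" using U p open_contains_ball by blast
  have "UNIV \<subseteq> span {v, w}"
    using vw by (intro card_ge_dim_independent) (auto simp: dim_UNIV)
  then have "p \<in> span {v, w}" by blast
  then obtain a b where ab: "p = a *\<^sub>R v + b *\<^sub>R w"
    by (auto simp: span_insert span_singleton algebra_simps)
  obtain N :: nat where N: "(norm v + norm w) / e < real N"
    using reals_Archimedean2 by blast
  have "0 \<le> (norm v + norm w) / e" using e(1) by simp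
  then have N0: "0 < real N" using N by linarith
  define y where "y = of_int \<lfloor>N * a\<rfloor> *\<^sub>R v + of_int \<lfloor>N * b\<rfloor> *\<^sub>R w"
  have "N *\<^sub>R p - y = (N * a - of_int \<lfloor>N * a\<rfloor>) *\<^sub>R v + (N * b - of_int \<lfloor>N * b\<rfloor>) *\<^sub>R w"
    by (simp add: y_def ab algebra_simps)
  then have "norm (N *\<^sub>R p - y) \<le> \<bar>N * a - of_int \<lfloor>N * a\<rfloor>\<bar> * norm v + \<bar>N * b - of_int \<lfloor>N * b\<rfloor>\<bar> * norm w"
    by (metis norm_scaleR norm_triangle_ineq)
  also have "\<dots> \<le> 1 * norm v + 1 * norm w"
    by (intro add_mono mult_right_mono norm_ge_zero; linarith)
  also have "\<dots> < N * e" using N e(1) by (simp add: field_simps)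
  finally have "norm (N *\<^sub>R p - y) < N * e" .
  moreover have "N *\<^sub>R p - y = N *\<^sub>R (p - (1 / N) *\<^sub>R y)"
    using N0 by (simp add: algebra_simps)
  ultimately have "norm (p - (1 / N) *\<^sub>R y) < e"
    using N0 by simp
  then have "(1 / N) *\<^sub>R y \<in> U" using e(2) by (auto simp: dist_norm)
  then have "N *\<^sub>R ((1 / N) *\<^sub>R y) \<in> U" using cone N0 by blast
  then have "y \<in> U" using N0 by simp
  moreover have "y \<in> R" unfolding R y_def by blast
  ultimately show ?thesis by blast
qed

text \<open>
  If the line \<open>n \<bullet> x = 0\<close> contains no nonzero lattice vector, Dirichlet approximation of the ratio
  of \<open>n \<bullet> v\<close> and \<open>n \<bullet> w\<close> for generators \<open>v\<close> and \<open>w\<close> gives lattice vectors \<open>y\<close> with \<open>n \<bullet> y\<close> nonzero and arbitrarily small. Such a vector need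
  not lie in the wedge, but walking from a point of the wedge in steps of \<open>y\<close> or \<open>- y\<close>, towards
  this edge and not towards the other one, ends within distance \<open>\<epsilon>\<close> of the edge.
\<close>

lemma lattice_points_near_irrational_edge:
  fixes n n' :: "real^2"
  assumes R: "planar_lattice R"
    and irrational: "\<And>v. v \<in> R \<Longrightarrow> v \<noteq> 0 \<Longrightarrow> n \<bullet> v \<noteq> 0"
    and x0: "x0 \<in> R" "0 < n \<bullet> x0" "0 < n' \<bullet> x0"
    and eps: "0 < \<epsilon>"
  shows "\<exists>x\<in>R. 0 < n \<bullet> x \<and> n \<bullet> x < \<epsilon> \<and> 0 < n' \<bullet> x"
proof -
  obtain v w where vw: "v \<noteq> w" "independent {v, w}"
    and Rvw: "R = {of_int a *\<^sub>R v + of_int b *\<^sub>R w | a b :: int. True}"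
    using R unfolding planar_lattice_def by blast
  have "v = of_int 1 *\<^sub>R v + of_int 0 *\<^sub>R w" "w = of_int 0 *\<^sub>R v + of_int 1 *\<^sub>R w" by simp_all
  then have vwR: "v \<in> R" "w \<in> R" unfolding Rvw by blast+
  have w0: "w \<noteq> 0" using vw(2) dependent_zero by blast
  define q where "q = n \<bullet> w"
  have q: "q \<noteq> 0" using irrational vwR w0 by (simp add: q_def)
  obtain N :: nat where N: "\<bar>q\<bar> / \<epsilon> < real N"
    using reals_Archimedean2 by blast
  have "0 \<le> \<bar>q\<bar> / \<epsilon>" using eps by simp
  then have N0: "0 < N" using N by linarith
  obtain h k where k: "0 < k" and hk: "\<bar>of_int k * (n \<bullet> v / q) - of_int h\<bar> < 1 / real N"
    using Dirichlet_approx[OF N0] by blast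
  define y where "y = of_int k *\<^sub>R v + of_int (- h) *\<^sub>R w"
  have yR: "y \<in> R" unfolding y_def by (rule lattice_combination[OF R vwR])
  have "y \<noteq> 0"
  proof
    assume "y = 0"
    then have "of_int k *\<^sub>R v = of_int h *\<^sub>R w" by (simp add: y_def)
    then have "(1 / of_int k) *\<^sub>R of_int k *\<^sub>R v = (of_int h / of_int k) *\<^sub>R w"
      by simp
    then have "v = (of_int h / of_int k) *\<^sub>R w"
      using k by simp
    then have "v \<in> span {w}" by (simp add: span_base span_mul)
    then show False using vw by (auto simp: dependent_def)
  qed
  then have ny: "n \<bullet> y \<noteq> 0" using irrational yR by blast
  have "n \<bullet> y = q * (of_int k * (n \<bullet> v / q) - of_int h)"
    using q by (simp add: y_def q_def inner_add_right inner_diff_right algebra_simps)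
  then have "\<bar>n \<bullet> y\<bar> = \<bar>q\<bar> * \<bar>of_int k * (n \<bullet> v / q) - of_int h\<bar>"
    by (simp add: abs_mult)
  also have "\<dots> < \<bar>q\<bar> * (1 / real N)"
    using hk q by (intro mult_strict_left_mono) auto
  also have "\<dots> < \<epsilon>" using N N0 eps by (simp add: field_simps)
  finally have small: "\<bar>n \<bullet> y\<bar> < \<epsilon>" .
  have "\<exists>y'\<in>R. \<bar>n \<bullet> y'\<bar> < \<epsilon> \<and> (0 < n \<bullet> y' \<and> 0 < n' \<bullet> y' \<or> n \<bullet> y' < 0 \<and> 0 \<le> n' \<bullet> y')"
  proof -
    have "- y \<in> R" using lattice_scale[OF R yR, of "-1"] by simp
    moreover have "0 < n \<bullet> y \<and> 0 < n' \<bullet> y \<or> n \<bullet> y < 0 \<and> 0 \<le> n' \<bullet> y \<or>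
        0 < n \<bullet> (- y) \<and> 0 < n' \<bullet> (- y) \<or> n \<bullet> (- y) < 0 \<and> 0 \<le> n' \<bullet> (- y)"
      using ny by (simp add: not_le) linarith
    moreover have "\<bar>n \<bullet> (- y)\<bar> < \<epsilon>" using small by simp
    ultimately show ?thesis using yR small by blast
  qed
  then obtain y' where y': "y' \<in> R" "\<bar>n \<bullet> y'\<bar> < \<epsilon>"
    and "0 < n \<bullet> y' \<and> 0 < n' \<bullet> y' \<or> n \<bullet> y' < 0 \<and> 0 \<le> n' \<bullet> y'" by blast
  from this(3) show ?thesis
  proof
    assume "0 < n \<bullet> y' \<and> 0 < n' \<bullet> y'"
    then show ?thesis using y' by auto
  next
    assume neg: "n \<bullet> y' < 0 \<and> 0 \<le> n' \<bullet> y'"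
    define \<delta> where "\<delta> = - (n \<bullet> y')"
    have d: "0 < \<delta>" "\<delta> < \<epsilon>" using neg y' by (auto simp: \<delta>_def)
    \<comment> \<open>the number of steps after which the next one would reach or cross the edge\<close>
    define j where "j = \<lceil>n \<bullet> x0 / \<delta>\<rceil> - 1"
    have "0 < n \<bullet> x0 / \<delta>" using x0 d by simp
    then have j0: "0 \<le> j" by (simp add: j_def)
    have "of_int j < n \<bullet> x0 / \<delta>" "n \<bullet> x0 / \<delta> \<le> of_int j + 1"
      by (simp_all add: j_def) linarith
    then have j: "of_int j * \<delta> < n \<bullet> x0" "n \<bullet> x0 \<le> of_int j * \<delta> + \<delta>"
      using d by (simp_all add: field_simps)
    define x where "x = x0 + of_int j *\<^sub>R y'"
    have "x \<in> R" unfolding x_def by (intro lattice_add lattice_scale R x0 y')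
    moreover have "n \<bullet> x = n \<bullet> x0 - of_int j * \<delta>"
      by (simp add: x_def \<delta>_def inner_add_right)
    moreover have "n' \<bullet> x = n' \<bullet> x0 + of_int j * (n' \<bullet> y')"
      by (simp add: x_def inner_add_right)
    moreover have "0 \<le> of_int j * (n' \<bullet> y')" using j0 neg by simp
    ultimately show ?thesis using j d x0 by (intro bexI[of _ x]) auto
  qed
qed

section \<open>One step of the walk\<close>

context wedge_walk
begin

lemma X_borel [measurable]: "X \<in> borel_measurable M"
  by (rule X_measurable)

lemma coordinate_borel [measurable]: "(\<lambda>\<omega>. X \<omega> $ i) \<in> borel_measurable M"
  by (rule borel_measurable_has_bochner_integral[OF mean_zero])

lemma lattice_borel: "A \<subseteq> R \<Longrightarrow> A \<in> sets borel"
  by (rule sets.countable) (simp_all add: countable_subset[OF _ countable_lattice[OF lattice]])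

lemma AE_first_step_transfer:
  assumes "AE \<omega> in M. \<xi> 1 \<omega> \<in> A" "A \<in> sets borel"
  shows "AE \<omega> in M. X \<omega> \<in> A"
proof -
  have xi: "\<xi> 1 \<in> borel_measurable M"
    using indep_steps unfolding indep_vars_def by simp
  have iff: "(AE x in distr M borel f. x \<in> A) \<longleftrightarrow> (AE \<omega> in M. f \<omega> \<in> A)"
    if "f \<in> borel_measurable M" for f
    using that assms(2) by (intro AE_distr_iff) simp_all
  have "distr M borel (\<xi> 1) = distr M borel X"
    by (rule distr_steps) (rule order_refl)
  then show ?thesis
    using assms(1) iff[OF xi] iff[OF X_borel] by metis
qed

lemma AE_X_lattice: "AE \<omega> in M. X \<omega> \<in> R"
proof (rule AE_first_step_transfer)
  show "AE \<omega> in M. \<xi> 1 \<omega> \<in> R"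
    using walk_in_lattice
  proof eventually_elim
    case (elim \<omega>)
    then have "walk \<xi> 1 \<omega> \<in> R" by blast
    then show ?case by (simp add: walk_def)
  qed
qed (simp add: lattice_borel)

text \<open>
  A walk that is outside the wedge after one step has exit time \<open>1\<close>, hence is on the boundary.
\<close>

lemma AE_step:
  assumes "x \<in> R \<inter> wedge \<alpha>" "\<alpha> < pi"
  shows "AE \<omega> in M. x + X \<omega> \<in> R \<inter> wedge \<alpha> \<or> x + X \<omega> \<in> R \<inter> frontier (wedge \<alpha>)"
proof -
  have cl: "y \<in> closure (wedge \<alpha>) \<longleftrightarrow> y \<in> wedge \<alpha> \<or> y \<in> frontier (wedge \<alpha>)" for y
    using frontier_wedge[OF angle(1) assms(2)] closure_subset by blast
  have "AE \<omega> in M. \<xi> 1 \<omega> \<in> {y. x + y \<in> closure (wedge \<alpha>)}"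
    using exit_on_boundary[OF assms(1)]
  proof eventually_elim
    case (elim \<omega>)
    then obtain n where n: "exit_time \<xi> (wedge \<alpha>) x \<omega> = enat n"
        "x + walk \<xi> n \<omega> \<in> frontier (wedge \<alpha>)" by blast
    have w1: "walk \<xi> 1 \<omega> = \<xi> 1 \<omega>" by (simp add: walk_def)
    show ?case
    proof (cases "x + \<xi> 1 \<omega> \<in> wedge \<alpha>")
      case True
      then show ?thesis by (simp add: cl)
    next
      case False
      then have "exit_time \<xi> (wedge \<alpha>) x \<omega> \<le> enat 1"
        unfolding exit_time_def by (intro Inf_lower) (auto simp: w1 simp del: One_nat_def)
      moreover have "enat 1 \<le> exit_time \<xi> (wedge \<alpha>) x \<omega>"
        unfolding exit_time_def by (intro Inf_greatest) auto
      ultimately have "n = 1" using n(1) by simp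
      then show ?thesis using n(2) w1 by (simp add: cl)
    qed
  qed
  moreover have "{y. x + y \<in> closure (wedge \<alpha>)} \<in> sets borel"
  proof -
    have "(\<lambda>y. x + y) \<in> borel_measurable borel" by simp
    then have "(\<lambda>y. x + y) -` closure (wedge \<alpha>) \<inter> space borel \<in> sets borel"
      by (rule measurable_sets) simp
    then show ?thesis by (simp add: vimage_def)
  qed
  ultimately have "AE \<omega> in M. X \<omega> \<in> {y. x + y \<in> closure (wedge \<alpha>)}"
    by (rule AE_first_step_transfer)
  with AE_X_lattice show ?thesis
  proof eventually_elim
    case (elim \<omega>)
    then show ?case using assms(1) lattice_add[OF lattice, of x "X \<omega>"] by (auto simp: cl)
  qed
qed

text \<open>
  A step from the wedge that is killed ends on the frontier, where \<open>f\<close> vanishes anyway.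
\<close>

lemma killed_iff_free:
  fixes f :: "real^2 \<Rightarrow> real"
  assumes "\<alpha> < pi" "\<And>x. x \<in> R \<inter> frontier (wedge \<alpha>) \<Longrightarrow> f x = 0" "x \<in> R \<inter> wedge \<alpha>"
    and [measurable]: "f \<in> borel_measurable borel"
  shows "has_bochner_integral M (\<lambda>\<omega>. indicator (wedge \<alpha>) (x + X \<omega>) * f (x + X \<omega>)) y \<longleftrightarrow>
    has_bochner_integral M (\<lambda>\<omega>. f (x + X \<omega>)) y"
proof (rule has_bochner_integral_cong_AE)
  have [measurable]: "wedge \<alpha> \<in> sets borel"
    using open_wedge[OF angle(1) assms(1)] by simp
  have step: "(\<lambda>\<omega>. x + X \<omega>) \<in> borel_measurable M"
    by measurable
  have "(\<lambda>\<omega>. indicator (wedge \<alpha>) (x + X \<omega>) :: real) \<in> borel_measurable M"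
    by (rule measurable_compose[OF step borel_measurable_indicator]) measurable
  moreover show "(\<lambda>\<omega>. f (x + X \<omega>)) \<in> borel_measurable M"
    by (rule measurable_compose[OF step assms(4)])
  ultimately show "(\<lambda>\<omega>. indicator (wedge \<alpha>) (x + X \<omega>) * f (x + X \<omega>)) \<in> borel_measurable M"
    by (rule borel_measurable_times)
  show "AE \<omega> in M. indicator (wedge \<alpha>) (x + X \<omega>) * f (x + X \<omega>) = f (x + X \<omega>)"
    using AE_step[OF assms(3,1)]
    by eventually_elim (auto simp: assms(2))
qed

lemma linear_form_moments:
  "has_bochner_integral M (\<lambda>\<omega>. n \<bullet> X \<omega>) 0"
  "has_bochner_integral M (\<lambda>\<omega>. (n \<bullet> X \<omega>)\<^sup>2) (n \<bullet> n)"
proof -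
  have "has_bochner_integral M (\<lambda>\<omega>. n $ 1 * X \<omega> $ 1 + n $ 2 * X \<omega> $ 2) (n $ 1 * 0 + n $ 2 * 0)"
    by (intro has_bochner_integral_add has_bochner_integral_mult_right mean_zero)
  then show "has_bochner_integral M (\<lambda>\<omega>. n \<bullet> X \<omega>) 0"
    by (simp add: inner_real2)
  have "has_bochner_integral M (\<lambda>\<omega>. (n $ 1)\<^sup>2 * (X \<omega> $ 1 * X \<omega> $ 1) + 2 * n $ 1 * n $ 2 * (X \<omega> $ 1 * X \<omega> $ 2)
      + (n $ 2)\<^sup>2 * (X \<omega> $ 2 * X \<omega> $ 2))
      ((n $ 1)\<^sup>2 * (if (1::2) = 1 then 1 else 0) + 2 * n $ 1 * n $ 2 * (if (1::2) = 2 then 1 else 0)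
      + (n $ 2)\<^sup>2 * (if (2::2) = 2 then 1 else 0))"
    by (intro has_bochner_integral_add has_bochner_integral_mult_right covariance_id)
  then show "has_bochner_integral M (\<lambda>\<omega>. (n \<bullet> X \<omega>)\<^sup>2) (n \<bullet> n)"
    by (simp add: inner_real2 power2_eq_square algebra_simps)
qed

text \<open>
  Without lattice points on the edge, there are points of the wedge at distance less than any
  \<open>\<epsilon>\<close> from it. A step from such a point stays on the inner side of the edge, so \<open>n \<bullet> X > - \<epsilon>\<close>. Then
  \<open>n \<bullet> X \<ge> 0\<close>, and mean zero forces \<open>n \<bullet> X = 0\<close>, against variance one.
\<close>

lemma lattice_point_on_edge:
  assumes n: "n \<bullet> n = 1" and "\<alpha> < pi"
    and wedge: "wedge \<alpha> = {x. 0 < n \<bullet> x \<and> 0 < n' \<bullet> x}"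
    and closure: "closure (wedge \<alpha>) = {x. 0 \<le> n \<bullet> x \<and> 0 \<le> n' \<bullet> x}"
    and indep: "\<And>x. n \<bullet> x = 0 \<Longrightarrow> n' \<bullet> x = 0 \<Longrightarrow> x = 0"
  shows "\<exists>v\<in>R. n \<bullet> v = 0 \<and> 0 < n' \<bullet> v"
proof (rule ccontr)
  assume none: "\<not> (\<exists>v\<in>R. n \<bullet> v = 0 \<and> 0 < n' \<bullet> v)"
  have irrational: "n \<bullet> v \<noteq> 0" if "v \<in> R" "v \<noteq> 0" for v
  proof
    assume "n \<bullet> v = 0"
    then have "n' \<bullet> v \<noteq> 0" using indep that by blast
    moreover have "- v \<in> R" using lattice_scale[OF lattice that(1), of "-1"] by simp
    ultimately consider "0 < n' \<bullet> v" | "- v \<in> R" "0 < n' \<bullet> (- v)"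
      by (auto simp: neq_iff)
    then show False
    proof cases
      case 1
      then show False using none that(1) \<open>n \<bullet> v = 0\<close> by blast
    next
      case 2
      moreover have "n \<bullet> (- v) = 0" using \<open>n \<bullet> v = 0\<close> by simp
      ultimately show False using none by blast
    qed
  qed
  have "\<exists>x\<in>R. x \<in> wedge \<alpha>"
    using lattice open_wedge[OF angle(1) assms(2)] wedge_nonempty[OF angle(1)] wedge_cone
    by (rule lattice_meets_open_cone)
  then obtain x0 where x0: "x0 \<in> R" "0 < n \<bullet> x0" "0 < n' \<bullet> x0"
    unfolding wedge by blast
  have bound: "AE \<omega> in M. - (1 / real (Suc k)) \<le> n \<bullet> X \<omega>" for k
  proof -
    obtain x where x: "x \<in> R" "0 < n \<bullet> x" "n \<bullet> x < 1 / real (Suc k)" "0 < n' \<bullet> x"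
      using lattice_points_near_irrational_edge[OF lattice irrational x0, of "1 / real (Suc k)"] by auto
    then have "x \<in> R \<inter> wedge \<alpha>" unfolding wedge by simp
    from AE_step[OF this assms(2)] show ?thesis
    proof eventually_elim
      case (elim \<omega>)
      then have "x + X \<omega> \<in> closure (wedge \<alpha>)"
        using closure_subset by (auto simp: frontier_def)
      then have "0 \<le> n \<bullet> (x + X \<omega>)" unfolding closure by simp
      then show ?case using x by (simp add: inner_add_right)
    qed
  qed
  have nonneg: "AE \<omega> in M. 0 \<le> n \<bullet> X \<omega>"
  proof -
    have "AE \<omega> in M. \<forall>k. - (1 / real (Suc k)) \<le> n \<bullet> X \<omega>"
      using bound by (simp add: AE_all_countable)
    then show ?thesis
    proof eventually_elim
      case (elim \<omega>)
      show ?case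
      proof (rule ccontr)
        assume "\<not> 0 \<le> n \<bullet> X \<omega>"
        then obtain k where "inverse (real (Suc k)) < - (n \<bullet> X \<omega>)"
          using reals_Archimedean[of "- (n \<bullet> X \<omega>)"] by auto
        moreover have "- (1 / real (Suc k)) \<le> n \<bullet> X \<omega>" using elim by blast
        ultimately show False by (simp add: inverse_eq_divide)
      qed
    qed
  qed
  have "AE \<omega> in M. n \<bullet> X \<omega> = 0"
    using linear_form_moments(1)[of n] nonneg
    by (subst integral_nonneg_eq_0_iff_AE[symmetric]) (auto simp: has_bochner_integral_iff)
  then have "AE \<omega> in M. (n \<bullet> X \<omega>)\<^sup>2 = 0" by simp
  then have "(\<integral>\<omega>. (n \<bullet> X \<omega>)\<^sup>2 \<partial>M) = 0"
    by (intro integral_eq_zero_AE)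
  then show False
    using linear_form_moments(2)[of n] n by (simp add: has_bochner_integral_iff)
qed

lemma edge_lattice_points:
  assumes "\<alpha> < pi"
  shows "\<exists>v\<in>R \<inter> frontier (wedge \<alpha>). v $ 2 = 0 \<and> 0 < v $ 1"
    and "\<exists>v\<in>R \<inter> frontier (wedge \<alpha>). edge_normal \<alpha> \<bullet> v = 0 \<and> 0 < v $ 2"
proof -
  let ?e = "axis 2 1 :: real^2"
  have s: "0 < sin \<alpha>" using angle assms by (intro sin_gt_zero)
  have indep: "x = 0" if "?e \<bullet> x = 0" "edge_normal \<alpha> \<bullet> x = 0" for x
    using that s by (simp add: inner_axis2 inner_edge_normal vec_eq_iff forall_2)
  have W: "wedge \<alpha> = {x. 0 < ?e \<bullet> x \<and> 0 < edge_normal \<alpha> \<bullet> x}"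
      "wedge \<alpha> = {x. 0 < edge_normal \<alpha> \<bullet> x \<and> 0 < ?e \<bullet> x}"
    using wedge_eq[OF angle(1) assms] by auto
  have C: "closure (wedge \<alpha>) = {x. 0 \<le> ?e \<bullet> x \<and> 0 \<le> edge_normal \<alpha> \<bullet> x}"
      "closure (wedge \<alpha>) = {x. 0 \<le> edge_normal \<alpha> \<bullet> x \<and> 0 \<le> ?e \<bullet> x}"
    using closure_wedge[OF angle(1) assms] by auto
  have F: "x \<in> frontier (wedge \<alpha>)" if "x \<in> closure (wedge \<alpha>)" "x \<notin> wedge \<alpha>" for x
    using that frontier_wedge[OF angle(1) assms] by blast
  have "\<exists>v\<in>R. ?e \<bullet> v = 0 \<and> 0 < edge_normal \<alpha> \<bullet> v"
    by (rule lattice_point_on_edge[OF _ assms W(1) C(1) indep]) (simp_all add: inner_axis_axis)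
  then obtain v where "v \<in> R" "?e \<bullet> v = 0" "0 < edge_normal \<alpha> \<bullet> v" by blast
  then have "v \<in> R \<inter> frontier (wedge \<alpha>)"
    by (auto intro!: F simp: C(1)) (simp add: W(1))
  moreover have "v $ 2 = 0" "0 < v $ 1"
    using s \<open>?e \<bullet> v = 0\<close> \<open>0 < edge_normal \<alpha> \<bullet> v\<close>
    by (simp_all add: inner_axis2 inner_edge_normal zero_less_mult_iff)
  ultimately show "\<exists>v\<in>R \<inter> frontier (wedge \<alpha>). v $ 2 = 0 \<and> 0 < v $ 1" by blast
  have "\<exists>v\<in>R. edge_normal \<alpha> \<bullet> v = 0 \<and> 0 < ?e \<bullet> v"
    by (rule lattice_point_on_edge[OF _ assms W(2) C(2) indep])
      (simp_all add: inner_real2 edge_normal_def flip: power2_eq_square)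
  then obtain v where "v \<in> R" "edge_normal \<alpha> \<bullet> v = 0" "0 < ?e \<bullet> v" by blast
  then have "v \<in> R \<inter> frontier (wedge \<alpha>)"
    by (auto intro!: F simp: C(1)) (simp add: W(1))
  then show "\<exists>v\<in>R \<inter> frontier (wedge \<alpha>). edge_normal \<alpha> \<bullet> v = 0 \<and> 0 < v $ 2"
    using \<open>edge_normal \<alpha> \<bullet> v = 0\<close> \<open>0 < ?e \<bullet> v\<close> by (auto simp: inner_axis2)
qed

lemma small_moments:
  "has_bochner_integral M (\<lambda>\<omega>. (X \<omega> $ 1) ^ 0 * (X \<omega> $ 2) ^ 0) 1"
  "has_bochner_integral M (\<lambda>\<omega>. (X \<omega> $ 1) ^ 1 * (X \<omega> $ 2) ^ 0) 0"
  "has_bochner_integral M (\<lambda>\<omega>. (X \<omega> $ 1) ^ 0 * (X \<omega> $ 2) ^ 1) 0"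
  "has_bochner_integral M (\<lambda>\<omega>. (X \<omega> $ 1) ^ 2 * (X \<omega> $ 2) ^ 0) 1"
  "has_bochner_integral M (\<lambda>\<omega>. (X \<omega> $ 1) ^ 1 * (X \<omega> $ 2) ^ 1) 0"
  "has_bochner_integral M (\<lambda>\<omega>. (X \<omega> $ 1) ^ 0 * (X \<omega> $ 2) ^ 2) 1"
  using mean_zero[of 1] mean_zero[of 2] covariance_id[of 1 1] covariance_id[of 1 2]
    covariance_id[of 2 2]
  by (simp_all add: has_bochner_integral_iff power2_eq_square prob_space)

text \<open>
  This is \<open>P = 1 + \<Delta>/2 + \<dots>\<close> on the level of coefficients. Integrability is required only of the moments
  that actually occur: for a polynomial of degree \<open>m\<close>, the coefficients of degree \<open>m - 2\<close> involve
  moments of order at most two.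
\<close>

lemma expectation_shift_coeff:
  assumes m: "2 \<le> m"
    and int: "\<And>k l. 3 \<le> k + l \<Longrightarrow> c (a + k) (b + l) \<noteq> 0 \<Longrightarrow>
      integrable M (\<lambda>\<omega>. (X \<omega> $ 1) ^ k * (X \<omega> $ 2) ^ l)"
  shows "has_bochner_integral M (\<lambda>\<omega>. shift_coeff m c (X \<omega> $ 1) (X \<omega> $ 2) a b)
    (c a b + laplace c a b / 2 + moment_source m (mixed_moment M X) c a b)"
proof -
  let ?g = "\<lambda>k l. real ((a + k) choose k) * real ((b + l) choose l) * c (a + k) (b + l)"
  let ?\<mu> = "mixed_moment M X"
  let ?S = "{(0,0), (1,0), (0,1), (2,0), (1,1), (0,2)} :: (nat \<times> nat) set"
  let ?I = "{(k, l) \<in> {..m} \<times> {..m}. 3 \<le> k + l}"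
  note mom = small_moments[unfolded has_bochner_integral_iff]
  have monomial: "has_bochner_integral M (\<lambda>\<omega>. ?g k l * ((X \<omega> $ 1) ^ k * (X \<omega> $ 2) ^ l)) (?g k l * ?\<mu> k l)" for k l
  proof (cases "c (a + k) (b + l) = 0")
    case True
    then show ?thesis by (simp add: has_bochner_integral_zero)
  next
    case False
    have "integrable M (\<lambda>\<omega>. (X \<omega> $ 1) ^ k * (X \<omega> $ 2) ^ l)"
    proof (cases "3 \<le> k + l")
      case True
      then show ?thesis using False int by blast
    next
      case False
      then have "(k, l) \<in> ?S" by auto
      then show ?thesis using mom by auto
    qed
    then show ?thesis
      unfolding mixed_moment_def
      by (intro has_bochner_integral_mult_right has_bochner_integral_integrable)
  qed
  have "(\<lambda>\<omega>. shift_coeff m c (X \<omega> $ 1) (X \<omega> $ 2) a b) =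
      (\<lambda>\<omega>. \<Sum>k\<le>m. \<Sum>l\<le>m. ?g k l * ((X \<omega> $ 1) ^ k * (X \<omega> $ 2) ^ l))"
    by (simp add: shift_coeff_def)
  then have "has_bochner_integral M (\<lambda>\<omega>. shift_coeff m c (X \<omega> $ 1) (X \<omega> $ 2) a b)
      (\<Sum>k\<le>m. \<Sum>l\<le>m. ?g k l * ?\<mu> k l)"
    using monomial by (auto intro!: has_bochner_integral_sum)
  moreover have "(\<Sum>k\<le>m. \<Sum>l\<le>m. ?g k l * ?\<mu> k l) =
      c a b + laplace c a b / 2 + moment_source m ?\<mu> c a b"
  proof -
    have split: "{..m} \<times> {..m} = ?S \<union> ?I" "?S \<inter> ?I = {}" using m by auto
    have fin: "finite ?I" by (rule finite_subset[of _ "{..m} \<times> {..m}"]) auto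
    have \<mu>: "?\<mu> 0 0 = 1" "?\<mu> 1 0 = 0" "?\<mu> 0 1 = 0" "?\<mu> 2 0 = 1" "?\<mu> 1 1 = 0" "?\<mu> 0 2 = 1"
      using mom by (simp_all add: mixed_moment_def)
    have ch: "real ((i + 2) choose 2) = real ((i + 2) * (i + 1)) / 2" for i
      by (simp add: choose_two real_of_nat_div)
    have "(\<Sum>k\<le>m. \<Sum>l\<le>m. ?g k l * ?\<mu> k l) = (\<Sum>(k, l)\<in>?S \<union> ?I. ?g k l * ?\<mu> k l)"
      unfolding split(1)[symmetric] by (rule sum.cartesian_product)
    also have "\<dots> = (\<Sum>(k, l)\<in>?S. ?g k l * ?\<mu> k l) + (\<Sum>(k, l)\<in>?I. ?g k l * ?\<mu> k l)"
      using fin split(2) by (intro sum.union_disjoint) auto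
    also have "(\<Sum>(k, l)\<in>?S. ?g k l * ?\<mu> k l) =
        c a b + (real ((a + 2) choose 2) * c (a + 2) b + real ((b + 2) choose 2) * c a (b + 2))"
      by (simp add: \<mu>[simplified])
    also have "\<dots> = c a b + laplace c a b / 2"
      unfolding ch laplace_def by (simp add: field_simps)
    finally show ?thesis by (simp add: moment_source_def)
  qed
  ultimately show ?thesis by simp
qed

end

section \<open>Separating the degrees\<close>

definition lower_coeffs :: "nat \<Rightarrow> (nat \<Rightarrow> nat \<Rightarrow> real) \<Rightarrow> nat \<Rightarrow> nat \<Rightarrow> real" where
  "lower_coeffs m c i j = (if i + j < m then c i j else 0)"

lemma u_eq_hom_part: "u m x = hom_part u_coeff m (x $ 1) (x $ 2)"
  by (simp add: u_def hom_part_u_coeff)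

lemma degree_bound_lower_coeffs: "degree_bound (m - 1) (lower_coeffs m c)"
  by (auto simp: degree_bound_def lower_coeffs_def)

lemma bivar_split_top:
  assumes "degree_bound m c" "1 \<le> m" "\<And>i j. i + j = m \<Longrightarrow> c i j = B * u_coeff i j"
  shows "bivar m c (x $ 1) (x $ 2) = B * u m x + poly2 (poly_of_coeffs (m - 1) (lower_coeffs m c)) x"
proof -
  obtain n where n: "m = Suc n" using assms(2) by (cases m) auto
  have "hom_part c m = hom_part (\<lambda>i j. B * u_coeff i j) m"
    by (rule hom_part_cong) (rule assms(3))
  then have "hom_part c m (x $ 1) (x $ 2) = hom_part (\<lambda>i j. B * u_coeff i j) m (x $ 1) (x $ 2)"
    by simp
  also have "\<dots> = B * u m x"
    by (simp add: u_eq_hom_part hom_part_def sum_distrib_left mult_ac)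
  finally have top: "hom_part c m (x $ 1) (x $ 2) = B * u m x" .
  have "poly2 (poly_of_coeffs (m - 1) (lower_coeffs m c)) x =
      (\<Sum>d\<le>n. hom_part (lower_coeffs m c) d (x $ 1) (x $ 2))"
    using degree_bound_lower_coeffs[of m c]
    by (simp add: poly2_poly_of_coeffs bivar_eq_sum_hom_part n)
  also have "\<dots> = (\<Sum>d\<le>n. hom_part c d (x $ 1) (x $ 2))"
  proof (rule sum.cong[OF refl])
    fix d assume "d \<in> {..n}"
    then have "hom_part (lower_coeffs m c) d = hom_part c d"
      by (intro hom_part_cong) (simp add: lower_coeffs_def n)
    then show "hom_part (lower_coeffs m c) d (x $ 1) (x $ 2) = hom_part c d (x $ 1) (x $ 2)"
      by simp
  qed
  finally show ?thesis
    unfolding bivar_eq_sum_hom_part[OF assms(1)] using top by (simp add: n)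
qed

text \<open>
  Replacing \<open>n\<close> by \<open>2 n\<close> and subtracting \<open>2 ^ N\<close> times the value at \<open>n\<close> eliminates the coefficient of
  \<open>n ^ N\<close> and multiplies the others by nonzero constants. This isolates the coefficients, and their
  integrability, from that of the sums.
\<close>

lemma has_bochner_integral_poly_coeffs:
  fixes G :: "nat \<Rightarrow> 'a \<Rightarrow> real"
  assumes "\<And>n :: nat. 1 \<le> n \<Longrightarrow>
    has_bochner_integral M (\<lambda>\<omega>. \<Sum>s\<le>N. real n ^ s * G s \<omega>) (\<Sum>s\<le>N. real n ^ s * e s)"
    and "s \<le> N"
  shows "has_bochner_integral M (G s) (e s)"
  using assms
proof (induction N arbitrary: G e s)
  case 0
  then show ?case using "0.prems"(1)[of 1] by simp
next
  case (Suc N)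
  define D where "D s = (2 :: real) ^ s - 2 ^ Suc N" for s
  have D: "D s \<noteq> 0" if "s \<le> N" for s
  proof -
    have "(2 :: real) ^ s < 2 ^ Suc N" using that by (intro power_strict_increasing) auto
    then show ?thesis by (simp add: D_def)
  qed
  have comb: "(\<Sum>s\<le>Suc N. real (2 * n) ^ s * g s) - 2 ^ Suc N * (\<Sum>s\<le>Suc N. real n ^ s * g s) =
      (\<Sum>s\<le>N. real n ^ s * (D s * g s))" for n and g :: "nat \<Rightarrow> real"
    by (simp add: D_def sum_distrib_left power_mult_distrib algebra_simps flip: sum_subtractf)
  have "has_bochner_integral M (\<lambda>\<omega>. \<Sum>s\<le>N. real n ^ s * (D s * G s \<omega>)) (\<Sum>s\<le>N. real n ^ s * (D s * e s))"
    if "1 \<le> n" for n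
    unfolding comb[symmetric] using that
    by (intro has_bochner_integral_diff has_bochner_integral_mult_right Suc.prems(1)) auto
  then have scaled: "has_bochner_integral M (\<lambda>\<omega>. D s * G s \<omega>) (D s * e s)" if "s \<le> N" for s
    using that by (rule Suc.IH)
  have low: "has_bochner_integral M (G s) (e s)" if "s \<le> N" for s
  proof -
    have cancel: "inverse (D s) * (D s * y) = y" for y
      using D[OF that] by (simp flip: mult.assoc)
    have "has_bochner_integral M (\<lambda>\<omega>. inverse (D s) * (D s * G s \<omega>)) (inverse (D s) * (D s * e s))"
      by (rule has_bochner_integral_mult_right) (rule scaled[OF that])
    then show ?thesis unfolding cancel .
  qed
  show ?case
  proof (cases "s \<le> N")
    case True
    then show ?thesis by (rule low)
  next
    case False
    then have s: "s = Suc N" using Suc.prems(2) by simp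
    have "has_bochner_integral M (\<lambda>\<omega>. (\<Sum>s\<le>Suc N. real 1 ^ s * G s \<omega>) - (\<Sum>s\<le>N. G s \<omega>))
        ((\<Sum>s\<le>Suc N. real 1 ^ s * e s) - (\<Sum>s\<le>N. e s))"
      by (intro has_bochner_integral_diff has_bochner_integral_sum Suc.prems(1) low) auto
    then show ?thesis by (simp add: s)
  qed
qed

lemma top_coeff_nonneg:
  fixes a :: "nat \<Rightarrow> real"
  assumes "\<And>n :: nat. 1 \<le> n \<Longrightarrow> 0 \<le> (\<Sum>s\<le>m. real n ^ s * a s)"
  shows "0 \<le> a m"
proof (rule ccontr)
  assume neg: "\<not> 0 \<le> a m"
  define p where "p = (\<Sum>s\<le>m. monom (- a s) s)"
  have p: "poly p x = - (\<Sum>s\<le>m. x ^ s * a s)" for x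
    by (simp add: p_def poly_sum poly_monom sum_negf mult.commute)
  have coeff: "coeff p s = (if s \<le> m then - a s else 0)" for s
    by (simp add: p_def coeff_sum sum.delta)
  have "degree p = m"
    using neg by (intro antisym degree_le le_degree) (auto simp: coeff)
  then have lc: "lead_coeff p = - a m" by (simp add: coeff)
  then obtain y where y: "\<And>x. y \<le> x \<Longrightarrow> - a m \<le> poly p x"
    using poly_pinfty_gt_lc[of p] neg by auto
  obtain n :: nat where "max y 1 \<le> real n" using real_arch_simple by blast
  then have "- a m \<le> poly p (real n)" "1 \<le> n" using y by auto
  then show False using assms[of n] neg p by simp
qed

lemma hom_part_zero_on_wedge:
  assumes "0 < \<alpha>" "\<alpha> < pi" and zero: "\<And>x. x \<in> wedge \<alpha> \<Longrightarrow> hom_part c d (x $ 1) (x $ 2) = 0"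
    and "i + j = d"
  shows "c i j = 0"
proof -
  define p where "p = (\<Sum>i\<le>d. monom (c i (d - i)) i)"
  have p: "poly p s = hom_part c d s 1" for s
    by (simp add: p_def poly_sum poly_monom hom_part_def)
  have s: "0 < sin \<alpha>" using assms by (intro sin_gt_zero)
  have "{cos \<alpha> / sin \<alpha> <..} \<subseteq> {s. poly p s = 0}"
  proof
    fix t assume "t \<in> {cos \<alpha> / sin \<alpha> <..}"
    then have "(vector [t, 1] :: real^2) \<in> wedge \<alpha>"
      using s by (simp add: wedge_eq[OF assms(1,2)] inner_axis2 inner_edge_normal field_simps)
    from zero[OF this] show "t \<in> {s. poly p s = 0}" by (simp add: p)
  qed
  then have "infinite {s. poly p s = 0}"
    using infinite_Ioi finite_subset by blast
  then have "p = 0" using poly_roots_finite by blast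
  then have "coeff p i = 0" by simp
  then show ?thesis
    using assms(4) by (auto simp: p_def coeff_sum sum.delta)
qed

lemma continuous_on_hom_part [continuous_intros]:
  "continuous_on A (\<lambda>x :: real^2. hom_part c d (x $ 1) (x $ 2))"
  unfolding hom_part_def by (intro continuous_intros)

text \<open>
  The set where a homogeneous polynomial is negative is an open cone, so it contains a lattice
  point unless it is empty.
\<close>

lemma lattice_sign_extends:
  assumes "planar_lattice R" "0 < \<alpha>" "\<alpha> < pi"
    and "\<And>x. x \<in> R \<inter> wedge \<alpha> \<Longrightarrow> 0 \<le> hom_part c d (x $ 1) (x $ 2)"
    and "x \<in> wedge \<alpha>"
  shows "0 \<le> hom_part c d (x $ 1) (x $ 2)"
proof (rule ccontr)
  assume neg: "\<not> 0 \<le> hom_part c d (x $ 1) (x $ 2)"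
  let ?U = "wedge \<alpha> \<inter> {x. hom_part c d (x $ 1) (x $ 2) < 0}"
  have "\<exists>x\<in>R. x \<in> ?U"
  proof (rule lattice_meets_open_cone[OF assms(1)])
    show "open ?U"
      by (intro open_Int open_wedge assms(2,3) open_Collect_less continuous_intros)
    show "?U \<noteq> {}" using assms(5) neg by auto
    show "t *\<^sub>R y \<in> ?U" if "y \<in> ?U" "0 < t" for y t
      using that by (simp add: wedge_cone hom_part_scale mult_less_0_iff)
  qed
  then show False using assms(4) by fastforce
qed

lemma frontier_wedge_cone:
  assumes "0 < \<alpha>" "\<alpha> < pi" "x \<in> frontier (wedge \<alpha>)" "0 < t"
  shows "t *\<^sub>R x \<in> frontier (wedge \<alpha>)"
  using assms(3,4)
  unfolding frontier_wedge[OF assms(1,2)] closure_wedge[OF assms(1,2)]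
  by (simp add: wedge_eq[OF assms(1,2)] zero_less_mult_iff zero_le_mult_iff)

lemma bivar_measurable:
  "(\<lambda>x :: real^2. bivar m c (x $ 1) (x $ 2)) \<in> borel_measurable borel"
  unfolding bivar_def by (intro borel_measurable_continuous_onI continuous_intros)

section \<open>Existence of the harmonic polynomial\<close>

text \<open>
  The scalars depend on \<open>m\<close> and the angle, not on the distribution of the step: the whole construction
  is carried out with the moments as variables.
\<close>

lemma moment_scalars_exist:
  assumes "2 \<le> m"
  shows "\<exists>\<Lambda>. \<forall>\<mu> p. \<mu> 0 0 = 1 \<longrightarrow>
    (\<forall>i j. coeff2 p i j = lower_coeffs m (corrected_u m \<alpha> \<mu> (m - 2)) i j) \<longrightarrow> coeffs_by_moments \<Lambda> m \<mu> p"
proof (rule moment_combination_scalars)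
  fix i j
  show "moment_combination m (\<lambda>\<mu>. lower_coeffs m (corrected_u m \<alpha> \<mu> (m - 2)) i j)"
  proof (cases "i + j < m")
    case True
    then show ?thesis using corrected_u_combination[OF assms] by (simp add: lower_coeffs_def)
  next
    case False
    then show ?thesis
      by (simp add: lower_coeffs_def low_moment_fun_imp_combination low_moment_fun_const)
  qed
qed

context wedge_walk
begin

lemma integrable_moment:
  assumes "integrable M (\<lambda>\<omega>. norm (X \<omega>) ^ m)" "k + l \<le> m"
  shows "integrable M (\<lambda>\<omega>. (X \<omega> $ 1) ^ k * (X \<omega> $ 2) ^ l)"
proof (rule Bochner_Integration.integrable_bound)
  show "integrable M (\<lambda>\<omega>. 1 + norm (X \<omega>) ^ m)"
    using assms(1) by simp
  show "(\<lambda>\<omega>. (X \<omega> $ 1) ^ k * (X \<omega> $ 2) ^ l) \<in> borel_measurable M"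
    by measurable
  show "AE \<omega> in M. norm ((X \<omega> $ 1) ^ k * (X \<omega> $ 2) ^ l) \<le> norm (1 + norm (X \<omega>) ^ m)"
  proof (rule AE_I2)
    fix \<omega>
    have "\<bar>X \<omega> $ 1\<bar> ^ k * \<bar>X \<omega> $ 2\<bar> ^ l \<le> norm (X \<omega>) ^ k * norm (X \<omega>) ^ l"
      by (intro mult_mono power_mono component_le_norm_cart) auto
    also have "\<dots> = norm (X \<omega>) ^ (k + l)" by (simp add: power_add)
    also have "\<dots> \<le> 1 + norm (X \<omega>) ^ m"
    proof (cases "norm (X \<omega>) \<le> 1")
      case True
      then have "norm (X \<omega>) ^ (k + l) \<le> 1" by (simp add: power_le_one)
      then show ?thesis by (simp add: add_increasing2)
    next
      case False
      then have "norm (X \<omega>) ^ (k + l) \<le> norm (X \<omega>) ^ m"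
        using assms(2) by (intro power_increasing) auto
      then show ?thesis by simp
    qed
    finally show "norm ((X \<omega> $ 1) ^ k * (X \<omega> $ 2) ^ l) \<le> norm (1 + norm (X \<omega>) ^ m)"
      by (simp add: abs_mult power_abs)
  qed
qed

lemma corrected_u_harmonic:
  assumes m: "2 \<le> m" and \<alpha>: "\<alpha> = pi / m" and int: "integrable M (\<lambda>\<omega>. norm (X \<omega>) ^ m)"
  shows "killed_harmonic M X R (wedge \<alpha>)
    (\<lambda>x. bivar m (corrected_u m \<alpha> (mixed_moment M X) (m - 2)) (x $ 1) (x $ 2))"
proof -
  define c where "c = corrected_u m \<alpha> (mixed_moment M X) (m - 2)"
  have pi: "\<alpha> < pi" using m pi_gt_zero by (simp add: \<alpha> field_simps)
  have bound: "degree_bound m c" unfolding c_def by (rule degree_bound_corrected_u) simp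
  have mean: "has_bochner_integral M (\<lambda>\<omega>. shift_coeff m c (X \<omega> $ 1) (X \<omega> $ 2) a b) (c a b)" for a b
  proof -
    have "integrable M (\<lambda>\<omega>. (X \<omega> $ 1) ^ k * (X \<omega> $ 2) ^ l)" if "c (a + k) (b + l) \<noteq> 0" for k l
    proof (rule integrable_moment[OF int])
      show "k + l \<le> m"
      proof (rule ccontr)
        assume "\<not> k + l \<le> m"
        then have "c (a + k) (b + l) = 0" using bound by (simp add: degree_bound_def)
        then show False using that by contradiction
      qed
    qed
    then have "has_bochner_integral M (\<lambda>\<omega>. shift_coeff m c (X \<omega> $ 1) (X \<omega> $ 2) a b)
        (c a b + laplace c a b / 2 + moment_source m (mixed_moment M X) c a b)"
      by (rule expectation_shift_coeff[OF m])
    moreover have "laplace c a b = - 2 * moment_source m (mixed_moment M X) c a b"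
      unfolding c_def using m by (intro laplace_corrected_u) auto
    ultimately show ?thesis by simp
  qed
  have zero: "bivar m c (x $ 1) (x $ 2) = 0" if "x \<in> frontier (wedge \<alpha>)" for x
    using angle(1) pi bound _ _ that
  proof (rule bivar_zero_on_frontier)
    show "c d 0 = 0" "hom_part c d (cos \<alpha>) (sin \<alpha>) = 0" for d
      using corrected_u_vanishes[of "m - 2" m "mixed_moment M X" d] m unfolding c_def \<alpha> by auto
  qed
  show ?thesis
    unfolding killed_harmonic_def c_def[symmetric]
  proof
    fix x assume "x \<in> wedge \<alpha> \<inter> R"
    then have x: "x \<in> R \<inter> wedge \<alpha>" by blast
    have "has_bochner_integral M (\<lambda>\<omega>. bivar m (shift_coeff m c (X \<omega> $ 1) (X \<omega> $ 2)) (x $ 1) (x $ 2))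
        (bivar m c (x $ 1) (x $ 2))"
      unfolding bivar_def
      by (intro has_bochner_integral_sum has_bochner_integral_mult_left mean)
    then have "has_bochner_integral M (\<lambda>\<omega>. bivar m c ((x + X \<omega>) $ 1) ((x + X \<omega>) $ 2))
        (bivar m c (x $ 1) (x $ 2))"
      by (simp add: bivar_shift[OF bound])
    then show "has_bochner_integral M (\<lambda>\<omega>. indicator (wedge \<alpha>) (x + X \<omega>) *
        bivar m c ((x + X \<omega>) $ 1) ((x + X \<omega>) $ 2)) (bivar m c (x $ 1) (x $ 2))"
      using killed_iff_free[OF pi _ x bivar_measurable] zero by blast
  qed
qed

lemma harmonic_correction_exists:
  assumes m: "2 \<le> m" and \<alpha>: "\<alpha> = pi / real m" and int: "integrable M (\<lambda>\<omega>. norm (X \<omega>) ^ m)"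
    and scalars: "\<And>p. (\<And>i j. coeff2 p i j =
        lower_coeffs m (corrected_u m (pi / real m) (mixed_moment M X) (m - 2)) i j) \<Longrightarrow>
        coeffs_by_moments \<Lambda> m (mixed_moment M X) p"
  shows "\<exists>r. total_degree_le r (m - 1) \<and>
    killed_harmonic M X R (wedge (pi / real m)) (\<lambda>x. u m x + poly2 r x) \<and>
    coeffs_by_moments \<Lambda> m (mixed_moment M X) r"
proof -
  define c where "c = corrected_u m \<alpha> (mixed_moment M X) (m - 2)"
  define r where "r = poly_of_coeffs (m - 1) (lower_coeffs m c)"
  have c: "degree_bound m c" "\<And>i j. i + j = m \<Longrightarrow> c i j = 1 * u_coeff i j"
    by (simp_all add: c_def degree_bound_corrected_u corrected_u_top)
  have "bivar m c (x $ 1) (x $ 2) = u m x + poly2 r x" for x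
    using bivar_split_top[OF c(1) _ c(2), of x] m by (simp add: r_def)
  then have "killed_harmonic M X R (wedge \<alpha>) (\<lambda>x. u m x + poly2 r x)"
    using corrected_u_harmonic[OF m \<alpha> int] unfolding c_def[symmetric] by (simp only:)
  moreover have "total_degree_le r (m - 1)"
    unfolding r_def by (rule poly2_poly_of_coeffs(2)[OF degree_bound_lower_coeffs])
  moreover have "coeffs_by_moments \<Lambda> m (mixed_moment M X) r"
    by (rule scalars)
      (simp only: r_def coeff2_poly_of_coeffs[OF degree_bound_lower_coeffs] c_def \<alpha>)
  ultimately show ?thesis unfolding \<alpha> by blast
qed

section \<open>The top part of a positive harmonic polynomial\<close>

text \<open>
  The expansion of \<open>h (x + X)\<close> contains powers of \<open>X\<close> whose means are not known to exist. The coefficient of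
  \<open>n ^ (m - 2)\<close> in \<open>h (n v + X)\<close> is a polynomial of degree two in \<open>X\<close>, and comparing the two ways of
  computing its mean, from harmonicity along \<open>n v\<close> and from the second moments, gives that the
  Laplacian of the top part vanishes at \<open>v\<close>.
\<close>

lemma harmonic_top_laplace:
  assumes pi: "\<alpha> < pi" and bound: "degree_bound m c" and m: "2 \<le> m"
    and harmonic: "killed_harmonic M X R (wedge \<alpha>) (\<lambda>x. bivar m c (x $ 1) (x $ 2))"
    and zero: "\<And>x. x \<in> R \<inter> frontier (wedge \<alpha>) \<Longrightarrow> bivar m c (x $ 1) (x $ 2) = 0"
    and ab: "a + b + 2 = m"
  shows "laplace c a b = 0"
proof -
  have lattice_zero: "hom_part (laplace c) (m - 2) (v $ 1) (v $ 2) = 0" if v: "v \<in> R \<inter> wedge \<alpha>" for v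
  proof -
    define G where "G s \<omega> = hom_part (shift_coeff m c (X \<omega> $ 1) (X \<omega> $ 2)) s (v $ 1) (v $ 2)" for s \<omega>
    have "has_bochner_integral M (\<lambda>\<omega>. \<Sum>s\<le>m. real n ^ s * G s \<omega>)
        (\<Sum>s\<le>m. real n ^ s * hom_part c s (v $ 1) (v $ 2))" if n: "1 \<le> n" for n :: nat
    proof -
      have "real n *\<^sub>R v \<in> R"
        using lattice_scale[OF lattice, of v "int n"] v by simp
      then have nv: "real n *\<^sub>R v \<in> R \<inter> wedge \<alpha>"
        using v n by (simp add: wedge_cone)
      then have "has_bochner_integral M (\<lambda>\<omega>. bivar m c ((real n *\<^sub>R v + X \<omega>) $ 1) ((real n *\<^sub>R v + X \<omega>) $ 2))
          (bivar m c ((real n *\<^sub>R v) $ 1) ((real n *\<^sub>R v) $ 2))"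
        using harmonic killed_iff_free[OF pi zero nv bivar_measurable]
        unfolding killed_harmonic_def by blast
      moreover have "bivar m c ((real n *\<^sub>R v + X \<omega>) $ 1) ((real n *\<^sub>R v + X \<omega>) $ 2) =
          (\<Sum>s\<le>m. real n ^ s * G s \<omega>)" for \<omega>
        unfolding vector_add_component bivar_shift[OF bound]
          bivar_eq_sum_hom_part[OF degree_bound_shift[OF bound]]
        by (simp add: hom_part_scale G_def)
      ultimately show ?thesis
        by (simp add: bivar_eq_sum_hom_part[OF bound] hom_part_scale)
    qed
    then have "has_bochner_integral M (G (m - 2)) (hom_part c (m - 2) (v $ 1) (v $ 2))"
      by (rule has_bochner_integral_poly_coeffs[OF _ diff_le_self])
    moreover have "has_bochner_integral M (G (m - 2))
        (hom_part (\<lambda>a b. c a b + laplace c a b / 2) (m - 2) (v $ 1) (v $ 2))"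
      unfolding G_def[abs_def] hom_part_def
    proof (intro has_bochner_integral_sum has_bochner_integral_mult_left)
      fix i assume i: "i \<in> {..m - 2}"
      let ?j = "m - 2 - i"
      have high: "c (i + k) (?j + l) = 0" if "3 \<le> k + l" for k l
        using that i m bound by (auto simp: degree_bound_def)
      have "has_bochner_integral M (\<lambda>\<omega>. shift_coeff m c (X \<omega> $ 1) (X \<omega> $ 2) i ?j)
          (c i ?j + laplace c i ?j / 2 + moment_source m (mixed_moment M X) c i ?j)"
      proof (rule expectation_shift_coeff[OF m])
        fix k l assume "3 \<le> k + l" "c (i + k) (?j + l) \<noteq> 0"
        with high[OF this(1)] show "integrable M (\<lambda>\<omega>. (X \<omega> $ 1) ^ k * (X \<omega> $ 2) ^ l)"
          by simp
      qed
      moreover have "moment_source m (mixed_moment M X) c i ?j = 0"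
        unfolding moment_source_def
      proof (rule sum.neutral, rule ballI)
        fix p assume "p \<in> {(k, l) \<in> {..m} \<times> {..m}. 3 \<le> k + l}"
        then have "3 \<le> fst p + snd p" by auto
        from high[OF this] show "(case p of (k, l) \<Rightarrow> real ((i + k) choose k) * real ((?j + l) choose l) *
            c (i + k) (?j + l) * mixed_moment M X k l) = 0"
          by (simp only: case_prod_unfold mult_zero_right mult_zero_left)
      qed
      ultimately show "has_bochner_integral M (\<lambda>\<omega>. shift_coeff m c (X \<omega> $ 1) (X \<omega> $ 2) i ?j)
          (c i ?j + laplace c i ?j / 2)" by simp
    qed
    ultimately have "hom_part c (m - 2) (v $ 1) (v $ 2) =
        hom_part (\<lambda>a b. c a b + laplace c a b / 2) (m - 2) (v $ 1) (v $ 2)"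
      by (rule has_bochner_integral_eq)
    also have "\<dots> = hom_part c (m - 2) (v $ 1) (v $ 2) + hom_part (laplace c) (m - 2) (v $ 1) (v $ 2) / 2"
      by (simp add: hom_part_def algebra_simps sum.distrib sum_divide_distrib)
    finally show ?thesis by simp
  qed
  have "hom_part (laplace c) (m - 2) (x $ 1) (x $ 2) = 0" if "x \<in> wedge \<alpha>" for x
  proof (rule antisym)
    show "0 \<le> hom_part (laplace c) (m - 2) (x $ 1) (x $ 2)"
      using lattice angle(1) pi _ that
      by (rule lattice_sign_extends) (simp add: lattice_zero)
    have minus: "hom_part (\<lambda>i j. - laplace c i j) (m - 2) y z = - hom_part (laplace c) (m - 2) y z" for y z
      by (simp add: hom_part_def sum_negf)
    have "0 \<le> hom_part (\<lambda>i j. - laplace c i j) (m - 2) (x $ 1) (x $ 2)"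
      using lattice angle(1) pi _ that
      by (rule lattice_sign_extends) (simp add: minus lattice_zero)
    then show "hom_part (laplace c) (m - 2) (x $ 1) (x $ 2) \<le> 0" by (simp add: minus)
  qed
  moreover have "a + b = m - 2" using ab by arith
  ultimately show ?thesis
    by (rule hom_part_zero_on_wedge[OF angle(1) pi])
qed

text \<open>
  The top part at \<open>v\<close> is the leading coefficient of \<open>h\<close> along the multiples of \<open>v\<close>.
\<close>

lemma top_part_nonneg:
  assumes bound: "degree_bound m c" and v: "v \<in> R" "v \<in> S"
    and cone: "\<And>t :: real. 0 < t \<Longrightarrow> t *\<^sub>R v \<in> S"
    and nonneg: "\<And>x. x \<in> R \<inter> S \<Longrightarrow> 0 \<le> bivar m c (x $ 1) (x $ 2)"
  shows "0 \<le> hom_part c m (v $ 1) (v $ 2)"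
proof (rule top_coeff_nonneg[where a="\<lambda>s. hom_part c s (v $ 1) (v $ 2)"])
  fix n :: nat assume "1 \<le> n"
  have "real n *\<^sub>R v \<in> R" using lattice_scale[OF lattice v(1), of "int n"] by simp
  then have "0 \<le> bivar m c ((real n *\<^sub>R v) $ 1) ((real n *\<^sub>R v) $ 2)"
    using \<open>1 \<le> n\<close> by (intro nonneg IntI cone) auto
  then show "0 \<le> (\<Sum>s\<le>m. real n ^ s * hom_part c s (v $ 1) (v $ 2))"
    by (simp add: bivar_eq_sum_hom_part[OF bound] hom_part_scale)
qed

lemma top_part_zero:
  assumes bound: "degree_bound m c" and pi: "\<alpha> < pi" and v: "v \<in> R \<inter> frontier (wedge \<alpha>)"
    and zero: "\<And>x. x \<in> R \<inter> frontier (wedge \<alpha>) \<Longrightarrow> bivar m c (x $ 1) (x $ 2) = 0"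
  shows "hom_part c m (v $ 1) (v $ 2) = 0"
proof (rule antisym)
  have cone: "t *\<^sub>R v \<in> frontier (wedge \<alpha>)" if "0 < t" for t
    using frontier_wedge_cone[OF angle(1) pi _ that] v by blast
  show "0 \<le> hom_part c m (v $ 1) (v $ 2)"
    by (rule top_part_nonneg[OF bound _ _ cone]) (use v zero in auto)
  have minus: "bivar m (\<lambda>i j. - c i j) x y = - bivar m c x y"
      "hom_part (\<lambda>i j. - c i j) m x y = - hom_part c m x y" for x y
    by (simp_all add: bivar_def hom_part_def sum_negf)
  have "0 \<le> hom_part (\<lambda>i j. - c i j) m (v $ 1) (v $ 2)"
    by (rule top_part_nonneg[OF _ _ _ cone]) (use v zero bound in \<open>auto simp: minus degree_bound_def\<close>)
  then show "hom_part c m (v $ 1) (v $ 2) \<le> 0" by (simp add: minus)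
qed

text \<open>
  The top part is \<open>B r\<^sup>m sin (m \<phi>)\<close> with \<open>B \<noteq> 0\<close> and \<open>m \<alpha> = k \<pi>\<close>. For \<open>k \<ge> 2\<close> it would take values of
  opposite signs at the angles \<open>\<pi> / (2 m)\<close> and \<open>3 \<pi> / (2 m)\<close>, both of which lie inside the wedge.
\<close>

lemma positive_harmonic_top:
  assumes pi: "\<alpha> < pi" and bound: "degree_bound m c" and top: "\<exists>i j. i + j = m \<and> c i j \<noteq> 0"
    and nonneg: "\<And>x. x \<in> R \<inter> wedge \<alpha> \<Longrightarrow> 0 \<le> bivar m c (x $ 1) (x $ 2)"
    and harmonic: "killed_harmonic M X R (wedge \<alpha>) (\<lambda>x. bivar m c (x $ 1) (x $ 2))"
    and zero: "\<And>x. x \<in> R \<inter> frontier (wedge \<alpha>) \<Longrightarrow> bivar m c (x $ 1) (x $ 2) = 0"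
  shows "1 \<le> m" "\<alpha> = pi / m" "\<exists>B. \<forall>i j. i + j = m \<longrightarrow> c i j = B * u_coeff i j"
proof -
  obtain v where v: "v \<in> R \<inter> frontier (wedge \<alpha>)" "v $ 2 = 0" "0 < v $ 1"
    using edge_lattice_points(1)[OF pi] by blast
  have c0: "c m 0 = 0"
    using top_part_zero[OF bound pi v(1) zero] v by (simp add: hom_part_on_axis)
  show m: "1 \<le> m"
  proof (rule ccontr)
    assume "\<not> 1 \<le> m"
    then have "m = 0" by simp
    then show False using c0 top by auto
  qed
  define B where "B = c (m - 1) 1 / m"
  have lap0: "laplace c a b = 0" if "a + b + 2 = m" for a b
    using that by (intro harmonic_top_laplace[OF pi bound _ harmonic zero that]) auto
  have cB: "c i j = B * u_coeff i j" if "i + j = m" for i j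
    unfolding B_def using lap0 c0 that by (rule harmonic_coeffs_unique)
  then show "\<exists>B. \<forall>i j. i + j = m \<longrightarrow> c i j = B * u_coeff i j" by blast
  have B0: "B \<noteq> 0" using top cB by fastforce
  have "hom_part c m = hom_part (\<lambda>i j. B * u_coeff i j) m"
    by (rule hom_part_cong) (rule cB)
  then have "hom_part c m x y = B * hom_part u_coeff m x y" for x y
    by (simp add: hom_part_def sum_distrib_left mult_ac)
  then have ray: "hom_part c m (cos \<phi>) (sin \<phi>) = B * sin (real m * \<phi>)" for \<phi>
    by (simp only: u_coeff_ray)
  have s: "0 < sin \<alpha>" using angle pi by (intro sin_gt_zero)
  obtain w where w: "w \<in> R \<inter> frontier (wedge \<alpha>)" "edge_normal \<alpha> \<bullet> w = 0" "0 < w $ 2"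
    using edge_lattice_points(2)[OF pi] by blast
  define r where "r = w $ 2 / sin \<alpha>"
  have r: "0 < r" "w $ 1 = r * cos \<alpha>" "w $ 2 = r * sin \<alpha>"
    using w s by (simp_all add: r_def inner_edge_normal field_simps)
  then have "hom_part c m (cos \<alpha>) (sin \<alpha>) = 0"
    using top_part_zero[OF bound pi w(1) zero] by (simp add: hom_part_scale)
  then have "sin (real m * \<alpha>) = 0" using B0 by (simp add: ray)
  then obtain k :: int where k: "real m * \<alpha> = of_int k * pi"
    using sin_zero_iff_int2 by blast
  have pos: "0 < real m * \<alpha>" using m angle by simp
  then have "1 \<le> k" unfolding k by (simp add: zero_less_mult_iff)
  have sign: "0 \<le> B * sin (real m * \<phi>)" if "0 < \<phi>" "\<phi> < \<alpha>" for \<phi>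
  proof -
    have x: "(vector [1 * cos \<phi>, 1 * sin \<phi>] :: real^2) \<in> wedge \<alpha>"
      unfolding wedge_def using that by (intro CollectI exI[of _ 1] exI[of _ \<phi>]) simp
    have "0 \<le> hom_part c m (y $ 1) (y $ 2)" if "y \<in> R \<inter> wedge \<alpha>" for y
      by (rule top_part_nonneg[OF bound _ _ _ nonneg]) (use that wedge_cone in auto)
    from lattice_sign_extends[OF lattice angle(1) pi this x]
    have "0 \<le> hom_part c m (cos \<phi>) (sin \<phi>)" by simp
    then show ?thesis by (simp add: ray)
  qed
  have "k = 1"
  proof (rule ccontr)
    assume "k \<noteq> 1"
    then have "2 * pi \<le> real m * \<alpha>" using \<open>1 \<le> k\<close> unfolding k by (intro mult_right_mono) auto
    then have *: "2 * pi / m \<le> \<alpha>" using m by (simp add: field_simps)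
    have quarter: "real m * (pi / (2 * m)) = pi / 2" "real m * (3 * pi / (2 * m)) = 3 / 2 * pi"
      using m by (simp_all add: field_simps)
    have "pi / (2 * m) < 2 * pi / m" "3 * pi / (2 * m) < 2 * pi / m"
      using m by (simp_all add: field_simps)
    then have "0 \<le> B * sin (pi / 2)" "0 \<le> B * sin (3 / 2 * pi)"
      using sign[of "pi / (2 * m)"] sign[of "3 * pi / (2 * m)"] * m unfolding quarter by auto
    then show False using B0 unfolding sin_3over2_pi by simp
  qed
  then show "\<alpha> = pi / m" using k m by (simp add: field_simps)
qed

lemma positive_harmonic_polynomial:
  assumes pi: "\<alpha> < pi" and deg: "has_total_degree h m"
    and nonneg: "\<And>x. x \<in> R \<inter> wedge \<alpha> \<Longrightarrow> 0 \<le> poly2 h x"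
    and harmonic: "killed_harmonic M X R (wedge \<alpha>) (poly2 h)"
    and zero: "\<And>x. x \<in> R \<inter> frontier (wedge \<alpha>) \<Longrightarrow> poly2 h x = 0"
  shows "\<alpha> = pi / real m"
    and "\<exists>c q. total_degree_le q (m - 1) \<and> (\<forall>x. poly2 h x - c * u m x = poly2 q x)"
proof -
  have le: "total_degree_le h m" and top: "\<exists>i j. i + j = m \<and> coeff2 h i j \<noteq> 0"
    using deg unfolding has_total_degree_def by auto
  have h: "poly2 h = (\<lambda>x. bivar m (coeff2 h) (x $ 1) (x $ 2))"
    using poly2_eq_bivar[OF le] by blast
  have bound: "degree_bound m (coeff2 h)" using le by (simp add: total_degree_le_iff)
  note result = positive_harmonic_top[OF pi bound top nonneg[unfolded h] harmonic[unfolded h]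
      zero[unfolded h]]
  show "\<alpha> = pi / real m" by (rule result(2))
  obtain B where B: "\<And>i j. i + j = m \<Longrightarrow> coeff2 h i j = B * u_coeff i j"
    using result(3) by blast
  let ?q = "poly_of_coeffs (m - 1) (lower_coeffs m (coeff2 h))"
  have "total_degree_le ?q (m - 1)"
    by (intro poly2_poly_of_coeffs(2) degree_bound_lower_coeffs)
  moreover have "poly2 h x - B * u m x = poly2 ?q x" for x
    using bivar_split_top[OF bound result(1) B, of x] by (simp add: h)
  ultimately show "\<exists>c q. total_degree_le q (m - 1) \<and> (\<forall>x. poly2 h x - c * u m x = poly2 q x)"
    by blast
qed

end

theorem theorem1:
  "\<exists>\<Lambda> :: nat \<Rightarrow> nat \<Rightarrow> nat \<Rightarrow> nat \<Rightarrow> nat \<Rightarrow> moment_poly.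
   \<forall>(M :: 'a measure) (X :: 'a \<Rightarrow> real^2) (\<xi> :: nat \<Rightarrow> 'a \<Rightarrow> real^2) (R :: (real^2) set) (\<alpha> :: real).
     wedge_walk M X \<xi> R \<alpha> \<longrightarrow>
       (\<forall>m :: nat. 2 \<le> m \<and> \<alpha> = pi / real m \<and> integrable M (\<lambda>\<omega>. norm (X \<omega>) ^ m) \<longrightarrow>
          (\<exists>r. total_degree_le r (m - 1) \<and>
               killed_harmonic M X R (wedge (pi / real m)) (\<lambda>x. u m x + poly2 r x) \<and>
               coeffs_by_moments (\<Lambda> m) m (mixed_moment M X) r)) \<and>
       (\<forall>(h :: real poly poly) (m :: nat).
          \<alpha> < pi \<and> has_total_degree h m \<and>
          (\<forall>x \<in> R \<inter> wedge \<alpha>. 0 \<le> poly2 h x) \<and>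
          killed_harmonic M X R (wedge \<alpha>) (poly2 h) \<and>
          (\<forall>x \<in> R \<inter> frontier (wedge \<alpha>). poly2 h x = 0) \<longrightarrow>
          \<alpha> = pi / real m \<and>
          (\<exists>(c :: real) q. total_degree_le q (m - 1) \<and> (\<forall>x. poly2 h x - c * u m x = poly2 q x)))"
proof -
  let ?corr = "\<lambda>m \<mu>. lower_coeffs m (corrected_u m (pi / real m) \<mu> (m - 2))"
  let ?good = "\<lambda>m \<Lambda>. \<forall>\<mu> p. \<mu> 0 0 = 1 \<longrightarrow> (\<forall>i j. coeff2 p i j = ?corr m \<mu> i j) \<longrightarrow>
      coeffs_by_moments \<Lambda> m \<mu> p"
  have "\<exists>\<Lambda>. 2 \<le> m \<longrightarrow> ?good m \<Lambda>" for m
    using moment_scalars_exist[of m "pi / real m"] by (cases "2 \<le> m") simp_all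
  then have "\<forall>m. \<exists>\<Lambda>. 2 \<le> m \<longrightarrow> ?good m \<Lambda>" ..
  from choice[OF this] obtain \<Lambda> where \<Lambda>: "\<forall>m. 2 \<le> m \<longrightarrow> ?good m (\<Lambda> m)" ..
  show ?thesis
  proof (rule exI[of _ \<Lambda>], intro allI impI conjI; elim conjE)
    fix M :: "'a measure" and X \<xi> R \<alpha> and m :: nat
    assume "wedge_walk M X \<xi> R \<alpha>"
    then interpret wedge_walk M X \<xi> R \<alpha> .
    assume m: "2 \<le> m" and *: "\<alpha> = pi / real m" "integrable M (\<lambda>\<omega>. norm (X \<omega>) ^ m)"
    have "mixed_moment M X 0 0 = 1" by (simp add: mixed_moment_def prob_space)
    with \<Lambda> m have "coeffs_by_moments (\<Lambda> m) m (mixed_moment M X) p"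
      if "\<And>i j. coeff2 p i j = ?corr m (mixed_moment M X) i j" for p
      using that by blast
    with m * show "\<exists>r. total_degree_le r (m - 1) \<and>
        killed_harmonic M X R (wedge (pi / real m)) (\<lambda>x. u m x + poly2 r x) \<and>
        coeffs_by_moments (\<Lambda> m) m (mixed_moment M X) r"
      by (rule harmonic_correction_exists)
  next
    fix M :: "'a measure" and X \<xi> R \<alpha> and h and m :: nat
    assume "wedge_walk M X \<xi> R \<alpha>"
    then interpret wedge_walk M X \<xi> R \<alpha> .
    assume "\<alpha> < pi" "has_total_degree h m" "\<forall>x \<in> R \<inter> wedge \<alpha>. 0 \<le> poly2 h x"
      "killed_harmonic M X R (wedge \<alpha>) (poly2 h)" "\<forall>x \<in> R \<inter> frontier (wedge \<alpha>). poly2 h x = 0"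
    note result = positive_harmonic_polynomial[OF this(1,2) bspec[OF this(3)] this(4) bspec[OF this(5)]]
    show "\<alpha> = pi / real m"
      by (rule result(1))
    show "\<exists>c q. total_degree_le q (m - 1) \<and> (\<forall>x. poly2 h x - c * u m x = poly2 q x)"
      by (rule result(2))
  qed
qed

end
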